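(* Let $K$ be an algebraic number field with ring of integers $\mathcal{O}_K$, let $\mathbf{X}\in\mathbb{Z}^{n\times n}$ be a symmetric matrix, and suppose that a nonzero matrix $\mathbf{Q}\in K^{n\times n}$ satisfies $\mathbf{Q}^{\mathsf T}\mathbf{Q}\in\mathcal{O}_K^{n\times n}$ and $\mathbf{X}\mathbf{Q}=\mathbf{Q}\mathbf{Y}$ for some $\mathbf{Y}\in\mathcal{O}_K^{n\times n}$. Let $\mathcal{L}\subseteq\mathcal{O}_K$ be the level of $\mathbf{Q}$. Assume that $\Delta_{\mathbf{X}}\neq 0$, with prime factorization $\Delta_{\mathbf{X}}=\pm p_1^{h_1}p_2^{h_2}\cdots p_m^{h_m}$ (distinct primes $p_i$, integers $h_i\geq 1$), that none of the primes $p_i$ is ramified in $K$, and that $h_i\leq 1$ for every $i$. Then $\mathcal{L}=\mathcal{O}_K$.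
   Context: The level of $\mathbf{Q}$ is the ideal $\mathcal{L}=\{r\in\mathcal{O}_K: r\mathbf{Q}\in\mathcal{O}_K^{n\times n}\}$. With $\phi_{\mathbf{X}}(x)=\det(x\mathbf{I}-\mathbf{X})$, the discriminant is $\Delta_{\mathbf{X}}=\det(\phi_{\mathbf{X}}'(\mathbf{X}))\in\mathbb{Z}$. A prime number $p$ is ramified in $K$ if there is a nonzero prime ideal $\mathcal{P}\subseteq\mathcal{O}_K$ such that $\mathcal{P}^2$ divides $p\mathcal{O}_K$. *)

theory Defs
  imports
    "Jordan_Normal_Form.Char_Poly"
    "HOL-Algebra.Ideal_Product"
    "HOL-Computational_Algebra.Computational_Algebra"
begin

definition number_field :: "'k :: field_char_0 itself \<Rightarrow> bool" where
  "number_field _ \<longleftrightarrow>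
     (\<exists>B :: 'k set. finite B \<and> module.span (\<lambda>(q :: rat) (x :: 'k). of_rat q * x) B = UNIV)"

lemma number_field_rat: "number_field TYPE(rat)"
proof -
  interpret vector_space "\<lambda>(q :: rat) (x :: rat). of_rat q * x"
    by unfold_locales (simp_all add: algebra_simps of_rat_add of_rat_mult)
  have "x \<in> span {1}" for x :: rat
    unfolding span_singleton by (rule range_eqI[of _ _ x]) simp
  then have "span {1 :: rat} = UNIV"
    by blast
  then show ?thesis
    unfolding number_field_def by (intro exI[of _ "{1}"]) simp
qed

definition ring_of_integers :: "'k :: field_char_0 ring" where
  "ring_of_integers =
     \<lparr>carrier = {x. algebraic_int x}, monoid.mult = (*), one = 1, ring.zero = 0, add = (+)\<rparr>"

definition integer_mats :: "nat \<Rightarrow> 'k :: field_char_0 mat set" where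
  "integer_mats n = {A \<in> carrier_mat n n. elements_mat A \<subseteq> carrier ring_of_integers}"

definition level :: "nat \<Rightarrow> 'k :: field_char_0 mat \<Rightarrow> 'k set" where
  "level n Q = {r \<in> carrier ring_of_integers. r \<cdot>\<^sub>m Q \<in> integer_mats n}"

text \<open>
  The value \<open>p(A)\<close> of a polynomial at a square matrix, that is \<open>\<Sum>k. coeff p k \<cdot>\<^sub>m A ^\<^sub>m k\<close>.  The
  sum is written entrywise because a matrix type without fixed dimension has no zero, so
  \<^const>\<open>sum\<close> is not available on it.
\<close>

definition poly_eval_mat :: "'a :: comm_ring_1 poly \<Rightarrow> 'a mat \<Rightarrow> 'a mat" where
  "poly_eval_mat p A = mat (dim_row A) (dim_row A)
     (\<lambda>(i, j). \<Sum>k\<le>degree p. coeff p k * (A ^\<^sub>m k) $$ (i, j))"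

definition mat_discriminant :: "int mat \<Rightarrow> int" where
  "mat_discriminant X = det (poly_eval_mat (pderiv (char_poly X)) X)"

definition ideal_divides :: "('a, 'b) ring_scheme \<Rightarrow> 'a set \<Rightarrow> 'a set \<Rightarrow> bool" where
  "ideal_divides R I J \<longleftrightarrow> (\<exists>H. ideal H R \<and> J = ideal_prod R I H)"

text \<open>The type argument is the number field, as in \<open>ramified_in TYPE('k) p\<close>.\<close>

definition ramified_in :: "'k :: field_char_0 itself \<Rightarrow> int \<Rightarrow> bool" where
  "ramified_in _ p \<longleftrightarrow>
     (\<exists>P :: 'k set. primeideal P ring_of_integers \<and> P \<noteq> {0} \<and>
        ideal_divides ring_of_integers
          (ideal_prod ring_of_integers P P) (cgenideal ring_of_integers (of_int p)))"

end

theory Submission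
  imports "HOL-Algebra.Algebraic_Closure_Type" Defs
begin

text \<open>
  Write \<open>O\<close> for the ring of integers, \<open>\<chi>\<close> for the characteristic polynomial of \<open>X\<close> and
  \<open>A = \<chi>'(X)\<close>, so that \<open>det A = \<Delta>\<close>. Over an algebraic closure \<open>A\<close> is the sum of the matrices
  \<open>G = adj (a - X)\<close> over the roots \<open>a\<close> of \<open>\<chi>\<close>. Each \<open>G\<close> is symmetric of rank at most one and a polynomial in
  \<open>X\<close>, whence \<open>(G Q)\<^sub>i\<^sub>j\<^sup>2 = G\<^sub>i\<^sub>i (Q\<^sup>T G Q)\<^sub>j\<^sub>j\<close> is integral. Therefore \<open>A Q\<close> is integral, with no condition on
  \<open>\<Delta>\<close> or on ramification, and so is \<open>\<Delta> Q = adj A (A Q)\<close>.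

  If a prime \<open>p\<close> divides \<open>\<Delta>\<close> exactly once, then \<open>adj A\<close> has rank one modulo \<open>p\<close>, and the integrality of
  \<open>Q\<^sup>T A Q\<close> shows that the squares of the entries of \<open>\<Delta> Q\<close> lie in \<open>pO\<close>. If \<open>p\<close> is unramified then
  \<open>O/pO\<close> is reduced, hence \<open>(\<Delta>/p) Q\<close> is integral. As \<open>\<Delta>\<close> is squarefree, the numbers \<open>\<Delta>/p\<close> together with
  \<open>\<Delta>\<close> generate the unit ideal of the integers.
\<close>

text \<open>Without the first line, \<open>X\<close> would denote the variable of a HOL-Algebra polynomial ring.\<close>

no_notation var ("X\<index>")
no_notation fps_nth (infixl "$" 75)

section \<open>Sums and products of algebraic integers\<close>

text \<open>The additive group generated by a family. It is indexed rather than a set because the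
  products \<open>x ^ a * y ^ b\<close>, to which it is applied, may coincide.\<close>

definition int_span :: "('i \<Rightarrow> 'a :: comm_ring_1) \<Rightarrow> 'i set \<Rightarrow> 'a set" where
  "int_span v I = range (\<lambda>c. \<Sum>i\<in>I. of_int (c i) * v i)"

lemma int_span_base:
  assumes "finite I" "i \<in> I"
  shows "v i \<in> int_span v I"
proof -
  have "v i = (\<Sum>j\<in>I. of_int (if j = i then 1 else 0) * v j)"
    using assms by (simp add: if_distrib if_distribR sum.delta cong: if_cong)
  then show ?thesis
    unfolding int_span_def by (intro range_eqI)
qed

lemma int_span_0: "0 \<in> int_span v I"
  unfolding int_span_def by (rule range_eqI[of _ _ "\<lambda>_. 0"]) simp

lemma int_span_add:
  assumes "a \<in> int_span v I" "b \<in> int_span v I"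
  shows "a + b \<in> int_span v I"
proof -
  obtain c d where "a = (\<Sum>i\<in>I. of_int (c i) * v i)" "b = (\<Sum>i\<in>I. of_int (d i) * v i)"
    using assms unfolding int_span_def by blast
  then have "a + b = (\<Sum>i\<in>I. of_int (c i + d i) * v i)"
    by (simp add: sum.distrib algebra_simps)
  then show ?thesis
    unfolding int_span_def by (intro range_eqI)
qed

lemma int_span_scale:
  assumes "a \<in> int_span v I"
  shows "of_int m * a \<in> int_span v I"
proof -
  obtain c where "a = (\<Sum>i\<in>I. of_int (c i) * v i)"
    using assms unfolding int_span_def by blast
  then have "of_int m * a = (\<Sum>i\<in>I. of_int (m * c i) * v i)"
    by (simp add: sum_distrib_left algebra_simps)
  then show ?thesis
    unfolding int_span_def by (intro range_eqI)
qed

lemma int_span_sum: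
  assumes "\<And>j. j \<in> J \<Longrightarrow> f j \<in> int_span v I"
  shows "sum f J \<in> int_span v I"
  using assms by (induction J rule: infinite_finite_induct) (auto intro: int_span_0 int_span_add)

lemma int_span_mult_closed:
  assumes "\<And>i. i \<in> I \<Longrightarrow> x * v i \<in> int_span v I" and "a \<in> int_span v I"
  shows "x * a \<in> int_span v I"
proof -
  obtain c where a: "a = (\<Sum>i\<in>I. of_int (c i) * v i)"
    using assms unfolding int_span_def by blast
  have "x * a = (\<Sum>i\<in>I. of_int (c i) * (x * v i))"
    unfolding a by (simp add: sum_distrib_left algebra_simps)
  then show ?thesis
    using assms(1) by (simp add: int_span_sum int_span_scale)
qed

text \<open>Determinant trick: multiplication by \<open>z\<close> acts on the family through an
  integer matrix \<open>M\<close>, and the vector \<open>w\<close> of the family is an eigenvector,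
  being nonzero thanks to \<open>v i0\<close>. Hence \<open>z\<close> is a root of the monic integer
  polynomial \<open>char_poly M\<close>.\<close>

lemma int_span_stable_imp_algebraic_int:
  fixes z :: "'a :: field_char_0"
  assumes fin: "finite I" and stable: "\<And>i. i \<in> I \<Longrightarrow> z * v i \<in> int_span v I"
    and nz: "i0 \<in> I" "v i0 \<noteq> 0"
  shows "algebraic_int z"
proof -
  have "\<exists>c. \<forall>i\<in>I. z * v i = (\<Sum>j\<in>I. of_int (c i j) * v j)"
    using stable unfolding int_span_def by (intro bchoice) blast
  then obtain c where c: "z * v i = (\<Sum>j\<in>I. of_int (c i j) * v j)" if "i \<in> I" for i
    by blast
  define n where "n = card I"
  obtain e where e: "bij_betw e {0..<n} I"
    using ex_bij_betw_nat_finite[OF fin] n_def by blast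
  define M where "M = mat n n (\<lambda>(i, j). c (e i) (e j))"
  define w where "w = vec n (\<lambda>i. v (e i))"
  have M: "M \<in> carrier_mat n n"
    by (simp add: M_def)
  have "map_mat of_int M *\<^sub>v w = z \<cdot>\<^sub>v w"
  proof (rule eq_vecI)
    fix i assume "i < dim_vec (z \<cdot>\<^sub>v w)"
    then have i: "i < n"
      by (simp add: w_def)
    have "(map_mat of_int M *\<^sub>v w) $ i = (\<Sum>j\<in>{0..<n}. of_int (c (e i) (e j)) * v (e j))"
      using i by (simp add: M_def w_def scalar_prod_def)
    also have "\<dots> = (\<Sum>j\<in>I. of_int (c (e i) j) * v j)"
      using e by (rule sum.reindex_bij_betw)
    also have "\<dots> = z * v (e i)"
      using c i e by (simp add: bij_betwE)
    finally show "(map_mat of_int M *\<^sub>v w) $ i = (z \<cdot>\<^sub>v w) $ i"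
      using i by (simp add: w_def)
  qed (simp add: M_def w_def)
  moreover have "w \<noteq> 0\<^sub>v n"
  proof -
    obtain k where k: "k < n" "e k = i0"
      using e nz(1) by (metis atLeastLessThan_iff bij_betw_iff_bijections)
    then have "w $ k \<noteq> 0"
      using nz(2) by (simp add: w_def)
    then show ?thesis
      using k by auto
  qed
  ultimately have "eigenvector (map_mat of_int M) w z"
    unfolding eigenvector_def by (simp add: M_def w_def)
  then have "eigenvalue (map_mat of_int M) z"
    unfolding eigenvalue_def by blast
  then have "poly (char_poly (map_mat of_int M)) z = 0"
    using M by (subst (asm) eigenvalue_root_char_poly[of _ n]) auto
  then have "poly (map_poly of_int (char_poly M)) z = 0"
    using of_int_hom.char_poly_hom[OF M, where 'a = 'a] by simp
  moreover have "lead_coeff (char_poly M) = 1"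
    using degree_monic_char_poly[OF M] by simp
  ultimately show ?thesis
    unfolding algebraic_int_altdef_ipoly by blast
qed

text \<open>The monic equation solved for its leading power, to be used as a rewriting rule for
  powers of \<open>x\<close>. The bound \<open>m > 0\<close> keeps the power 1 among those below
  \<open>m\<close>.\<close>

lemma algebraic_int_power_relation:
  fixes x :: "'a :: field_char_0"
  assumes "algebraic_int x"
  obtains m c where "m > 0" "x ^ m = (\<Sum>k<m. of_int (c k) * x ^ k)"
proof -
  obtain p where p: "poly (map_poly of_int p) x = 0" "lead_coeff p = 1"
    using assms unfolding algebraic_int_altdef_ipoly by blast
  let ?m = "degree p"
  have m: "?m > 0"
  proof (rule ccontr)
    assume "\<not> ?m > 0"
    then obtain c where "p = [:c:]"
      by (auto elim: degree_eq_zeroE)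
    then show False
      using p by simp
  qed
  have "0 = (\<Sum>k\<le>?m. of_int (coeff p k) * x ^ k)"
    using p(1) by (simp add: poly_altdef coeff_map_poly)
  also have "{..?m} = insert ?m {..<?m}"
    by auto
  finally have "x ^ ?m = (\<Sum>k<?m. of_int (- coeff p k) * x ^ k)"
    using p(2) by (simp add: sum_negf add_eq_0_iff)
  then show thesis
    by (rule that[OF m])
qed

text \<open>The products \<open>x ^ a * y ^ b\<close> with \<open>a < m\<close> and
  \<open>b < l\<close> generate a group stable under \<open>x\<close> and under \<open>y\<close>,
  since a power that reaches \<open>m\<close> or \<open>l\<close> is rewritten by its monic
  relation. The group is then stable under \<open>x + y\<close> and \<open>x * y\<close>.\<close>

lemma algebraic_int_add_mult:
  fixes x y :: "'a :: field_char_0"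
  assumes "algebraic_int x" "algebraic_int y"
  shows "algebraic_int (x + y)" "algebraic_int (x * y)"
proof -
  obtain m c where m: "m > 0" and x: "x ^ m = (\<Sum>k<m. of_int (c k) * x ^ k)"
    using algebraic_int_power_relation[OF assms(1)] by blast
  obtain l d where l: "l > 0" and y: "y ^ l = (\<Sum>k<l. of_int (d k) * y ^ k)"
    using algebraic_int_power_relation[OF assms(2)] by blast
  define I where "I = {..<m} \<times> {..<l}"
  define v where "v = (\<lambda>(a, b). x ^ a * y ^ b)"
  have fin: "finite I" and I0: "(0, 0) \<in> I" and v0: "v (0, 0) \<noteq> 0"
    using m l by (auto simp: I_def v_def)
  have base: "x ^ a * y ^ b \<in> int_span v I" if "a < m" "b < l" for a b
    using int_span_base[OF fin, of "(a, b)" v] that by (simp add: I_def v_def)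
  have X: "x * v i \<in> int_span v I" if iI: "i \<in> I" for i
  proof -
    obtain a b where i: "i = (a, b)" "a < m" "b < l"
      using iI by (auto simp: I_def)
    show ?thesis
    proof (cases "Suc a < m")
      case True
      then show ?thesis
        using base[of "Suc a" b] i by (simp add: v_def mult.assoc)
    next
      case False
      then have "Suc a = m"
        using i by simp
      then have "x * v i = x ^ m * y ^ b"
        using i by (auto simp: v_def mult.assoc)
      also have "\<dots> = (\<Sum>k<m. of_int (c k) * (x ^ k * y ^ b))"
        unfolding x by (simp add: sum_distrib_right mult.assoc)
      finally show ?thesis
        using i by (auto intro!: int_span_sum int_span_scale base)
    qed
  qed
  have Y: "y * v i \<in> int_span v I" if iI: "i \<in> I" for i
  proof -
    obtain a b where i: "i = (a, b)" "a < m" "b < l"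
      using iI by (auto simp: I_def)
    show ?thesis
    proof (cases "Suc b < l")
      case True
      then show ?thesis
        using base[of a "Suc b"] i by (simp add: v_def mult.left_commute)
    next
      case False
      then have "Suc b = l"
        using i by simp
      then have "y * v i = x ^ a * y ^ l"
        using i by (auto simp: v_def mult.left_commute)
      also have "\<dots> = (\<Sum>k<l. of_int (d k) * (x ^ a * y ^ k))"
        unfolding y by (simp add: sum_distrib_left mult.left_commute)
      finally show ?thesis
        using i by (auto intro!: int_span_sum int_span_scale base)
    qed
  qed
  show "algebraic_int (x + y)"
    by (rule int_span_stable_imp_algebraic_int[where v = v and I = I, OF fin _ I0 v0])
      (simp add: distrib_right int_span_add X Y)
  show "algebraic_int (x * y)"
    by (rule int_span_stable_imp_algebraic_int[where v = v and I = I, OF fin _ I0 v0])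
      (simp add: mult.assoc int_span_mult_closed X Y)
qed

lemmas algebraic_int_add [intro] = algebraic_int_add_mult(1)
lemmas algebraic_int_mult [intro] = algebraic_int_add_mult(2)

lemma algebraic_int_diff [intro]:
  fixes x y :: "'a :: field_char_0"
  shows "algebraic_int x \<Longrightarrow> algebraic_int y \<Longrightarrow> algebraic_int (x - y)"
  using algebraic_int_add[of x "- y"] by simp

lemma algebraic_int_power [intro]:
  fixes x :: "'a :: field_char_0"
  shows "algebraic_int x \<Longrightarrow> algebraic_int (x ^ n)"
  by (induction n) auto

lemma algebraic_int_sum [intro]:
  fixes f :: "'i \<Rightarrow> 'a :: field_char_0"
  shows "(\<And>i. i \<in> I \<Longrightarrow> algebraic_int (f i)) \<Longrightarrow> algebraic_int (sum f I)"
  by (induction I rule: infinite_finite_induct) auto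

lemma algebraic_int_power_imp:
  fixes x :: "'a :: field_char_0"
  assumes "algebraic_int (x ^ n)" "n > 0"
  shows "algebraic_int x"
  by (rule algebraic_int_root[OF assms(1), of "monom 1 n"])
    (use assms(2) in \<open>auto simp: poly_monom degree_monom_eq\<close>)

text \<open>Integrality can be tested in the algebraic closure, where the characteristic polynomial
  splits.\<close>

lemma algebraic_int_to_ac_iff [simp]:
  fixes x :: "'a :: field_char_0"
  shows "algebraic_int (to_ac x) \<longleftrightarrow> algebraic_int x"
proof -
  have "poly (map_poly of_int p) (to_ac x) = to_ac (poly (map_poly of_int p) x)" for p
    by (induction p) (simp_all add: map_poly_pCons)
  then show ?thesis
    unfolding algebraic_int_altdef_ipoly by simp
qed

section \<open>Residues modulo an unramified prime\<close>

text \<open>Descent: 0 is divisible by \<open>p\<close>, so all coefficients are, and dividing them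
  by \<open>p\<close> leaves another vanishing combination. This turns independence modulo
  \<open>p\<close> into independence over the rationals.\<close>

lemma power_dvd_of_int_combination_eq_0:
  fixes E :: "'k :: field_char_0 set"
  assumes p: "prime (p :: int)"
    and indep: "\<And>c. algebraic_int ((\<Sum>e\<in>E. of_int (c e) * e) / of_int p) \<Longrightarrow> \<forall>e\<in>E. p dvd c e"
    and "(\<Sum>e\<in>E. of_int (c e) * e) = 0"
  shows "\<forall>e\<in>E. p ^ k dvd c e"
  using assms(3)
proof (induction k arbitrary: c)
  case (Suc k)
  have dvd: "\<forall>e\<in>E. p dvd c e"
    using Suc.prems by (intro indep) simp
  have "of_int p * (\<Sum>e\<in>E. of_int (c e div p) * e) = (\<Sum>e\<in>E. of_int (c e) * e)"
    unfolding sum_distrib_left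
  proof (rule sum.cong)
    fix e assume "e \<in> E"
    then have "c e = p * (c e div p)"
      using dvd by simp
    then show "of_int p * (of_int (c e div p) * e) = of_int (c e) * e"
      by (metis mult.assoc of_int_mult)
  qed simp
  then have "(\<Sum>e\<in>E. of_int (c e div p) * e) = 0"
    using Suc.prems p by simp
  then have "\<forall>e\<in>E. p ^ k dvd c e div p"
    by (rule Suc.IH)
  then show ?case
    using dvd p by (auto simp: dvd_div_iff_mult mult.commute)
qed simp

lemma common_denominator:
  fixes u :: "'i \<Rightarrow> rat"
  assumes "finite E"
  obtains m :: int and c where "m > 0" "\<And>e. e \<in> E \<Longrightarrow> of_int m * u e = of_int (c e)"
proof -
  define m where "m = (\<Prod>e\<in>E. snd (quotient_of (u e)))"
  have pos: "m > 0"
    unfolding m_def by (intro prod_pos) (simp add: quotient_of_denom_pos')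
  have "\<exists>c. of_int m * u e = of_int c" if "e \<in> E" for e
  proof -
    obtain a b where ab: "quotient_of (u e) = (a, b)"
      by fastforce
    have "b dvd m"
      unfolding m_def using dvd_prodI[OF assms that, of "\<lambda>e. snd (quotient_of (u e))"] ab by simp
    then obtain t where "m = b * t"
      by blast
    moreover have "u e = of_int a / of_int b" "b \<noteq> 0"
      using quotient_of_div[OF ab] quotient_of_denom_pos[OF ab] by auto
    ultimately have "of_int m * u e = of_int (a * t)"
      by simp
    then show ?thesis
      by blast
  qed
  then obtain c where "\<And>e. e \<in> E \<Longrightarrow> of_int m * u e = of_int (c e)"
    by metis
  with pos show thesis
    by (rule that)
qed

text \<open>A family of integers that is independent modulo \<open>p\<close> is independent over the rationals, so there is
  a maximal one; its combinations with coefficients in \<open>{0..<p}\<close> represent every residue class that contains no member of the family.\<close>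

lemma finite_residues:
  assumes K: "number_field TYPE('k)" and p: "prime (p :: int)"
  obtains S :: "'k :: field_char_0 set" where "finite S"
    and "\<And>r. algebraic_int r \<Longrightarrow> \<exists>s\<in>S. algebraic_int ((r - s) / of_int p)"
proof -
  obtain B :: "'k set" where B: "finite B" "module.span (\<lambda>(q :: rat) (x :: 'k). of_rat q * x) B = UNIV"
    using K unfolding number_field_def by blast
  interpret V: vector_space "\<lambda>(q :: rat) (x :: 'k). of_rat q * x"
    by unfold_locales (simp_all add: algebra_simps of_rat_add of_rat_mult)
  have p1: "p > 1" and p0: "p \<noteq> 0"
    using prime_gt_1_int[OF p] by auto
  define comb where "comb = (\<lambda>E (c :: 'k \<Rightarrow> int). \<Sum>e\<in>E. of_int (c e) * e)"
  \<comment> \<open>Independence modulo \<open>p\<close>: a combination lies in pO only if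
    \<open>p\<close> divides all its coefficients.\<close>
  define indep where "indep = (\<lambda>E. finite E \<and> (\<forall>e\<in>E. algebraic_int e) \<and>
    (\<forall>c. algebraic_int (comb E c / of_int p) \<longrightarrow> (\<forall>e\<in>E. p dvd c e)))"
  have card_le: "card E \<le> card B" if E: "indep E" for E
  proof -
    have fin: "finite E"
      using E by (simp add: indep_def)
    have "\<not> V.dependent E"
    proof
      assume "V.dependent E"
      then obtain u v where v: "v \<in> E" "u v \<noteq> 0" and sum: "(\<Sum>e\<in>E. of_rat (u e) * e) = 0"
        unfolding V.dependent_finite[OF fin] by blast
      obtain m c where m: "m > 0" and c: "\<And>e. e \<in> E \<Longrightarrow> of_int m * u e = of_int (c e)"
        using common_denominator[OF fin] by blast
      have c': "of_int (c e) = of_int m * (of_rat (u e) :: 'k)" if "e \<in> E" for e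
        using c[OF that] by (metis of_rat_mult of_rat_of_int_eq)
      have "comb E c = of_int m * (\<Sum>e\<in>E. of_rat (u e) * e)"
        unfolding comb_def sum_distrib_left by (rule sum.cong) (simp_all add: c' mult.assoc)
      then have "(\<Sum>e\<in>E. of_int (c e) * e) = 0"
        by (simp add: sum comb_def)
      then have dvd: "p ^ k dvd c v" for k
        using power_dvd_of_int_combination_eq_0[OF p, of E c k] E v(1)
        unfolding indep_def comb_def by blast
      have "c v \<noteq> 0"
        using c[OF v(1)] v(2) m by auto
      \<comment> \<open>With this exponent p^k >= 2^k > k = |c v|, which is too large for a divisor
        of the nonzero \<open>c v\<close>.\<close>
      define k where "k = nat \<bar>c v\<bar>"
      have "p ^ k \<le> \<bar>c v\<bar>"
        using dvd_imp_le_int[OF \<open>c v \<noteq> 0\<close> dvd[of k]] p1 by simp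
      moreover have "int k < 2 ^ k"
        using of_nat_less_two_power[of k, where 'a = int] by simp
      moreover have "(2 :: int) ^ k \<le> p ^ k"
        using p1 by (intro power_mono) auto
      ultimately show False
        unfolding k_def by simp
    qed
    then show ?thesis
      using V.independent_span_bound[OF B(1)] B(2) by auto
  qed
  have "indep {}"
    by (simp add: indep_def)
  then obtain E where E: "indep E" and max: "\<And>F. indep F \<Longrightarrow> card F \<le> card E"
    using ex_has_greatest_nat[of indep "{}" card "Suc (card B)"] card_le by (auto simp: less_Suc_eq_le)
  have fin: "finite E" and int_E: "\<And>e. e \<in> E \<Longrightarrow> algebraic_int e"
    using E by (auto simp: indep_def)
  \<comment> \<open>\<open>E\<close> is added because a member of \<open>E\<close> does not enlarge
    the family, so maximality only speaks of \<open>r\<close> outside \<open>E\<close>.\<close>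
  define S where "S = E \<union> comb E ` (E \<rightarrow>\<^sub>E {0..<p})"
  have "\<exists>s\<in>S. algebraic_int ((r - s) / of_int p)" if r: "algebraic_int r" for r
  proof (cases "r \<in> E")
    case True
    then show ?thesis
      unfolding S_def by (intro bexI[of _ r]) auto
  next
    case False
    have "\<not> indep (insert r E)"
      using max[of "insert r E"] False fin by auto
    then obtain c where c: "algebraic_int (comb (insert r E) c / of_int p)"
        and not_dvd: "\<not> (\<forall>e\<in>insert r E. p dvd c e)"
      using fin int_E r unfolding indep_def by auto
    define t where "t = comb (insert r E) c"
    have t: "t = of_int (c r) * r + comb E c"
      using fin False by (simp add: t_def comb_def)
    \<comment> \<open>Otherwise the relation restricts to \<open>E\<close>, and the independence of
      \<open>E\<close> makes \<open>p\<close> divide every coefficient.\<close>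
    have "\<not> p dvd c r"
    proof
      assume dvd: "p dvd c r"
      then obtain q where "c r = p * q"
        by blast
      then have "comb E c / of_int p = t / of_int p - of_int q * r"
        using p0 by (simp add: t field_simps)
      then have "algebraic_int (comb E c / of_int p)"
        using c r by (simp add: t_def algebraic_int_diff algebraic_int_mult)
      then show False
        using E dvd not_dvd by (auto simp: indep_def)
    qed
    then have "coprime (c r) p"
      using p by (metis coprime_commute prime_imp_coprime)
    then obtain b y where bez: "b * c r + y * p = 1"
      using bezout_int[of "c r" p] by (metis coprime_imp_gcd_eq_1)
    \<comment> \<open>As \<open>b\<close> inverts \<open>c r\<close> modulo \<open>p\<close>,
      \<open>r\<close> is congruent to \<open>- b\<close> times \<open>comb E c\<close>. The
      coefficients of that combination are split into remainders \<open>g\<close> and quotients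
      \<open>h\<close>; the restriction to \<open>E\<close> puts \<open>g\<close> into the finite
      extensional function space.\<close>
    define g where "g = restrict (\<lambda>e. (- b * c e) mod p) E"
    define h where "h = (\<lambda>e. (- b * c e) div p)"
    have "- b * c e = p * h e + g e" if "e \<in> E" for e
      using that by (simp add: g_def h_def)
    then have "comb E g = (\<Sum>e\<in>E. of_int (- b * c e - p * h e) * e)"
      unfolding comb_def by (intro sum.cong) auto
    also have "\<dots> = - of_int b * comb E c - of_int p * comb E h"
      unfolding comb_def
      by (simp add: sum_subtractf sum_distrib_left algebra_simps sum_negf flip: sum_negf)
    finally have g: "comb E g = - of_int b * comb E c - of_int p * comb E h" .
    have "r = of_int (b * c r + y * p) * r"
      by (simp add: bez)
    then have "(r - comb E g) / of_int p = of_int b * (t / of_int p) + of_int y * r + comb E h"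
      using p0 by (simp add: g t field_simps)
    moreover have "algebraic_int (comb E h)"
      unfolding comb_def using int_E by (intro algebraic_int_sum algebraic_int_mult) auto
    then have "algebraic_int (of_int b * (t / of_int p) + of_int y * r + comb E h)"
      using c r unfolding t_def by (intro algebraic_int_add algebraic_int_mult) auto
    ultimately have "algebraic_int ((r - comb E g) / of_int p)"
      by (simp only:)
    moreover have "g \<in> E \<rightarrow>\<^sub>E {0..<p}"
      using p1 by (auto simp: g_def)
    ultimately show ?thesis
      unfolding S_def by blast
  qed
  moreover have "finite S"
    unfolding S_def using fin by (simp add: finite_PiE)
  ultimately show thesis
    using that by blast
qed

section \<open>Ideals of the ring of integers and ramification\<close>

lemma cring_ring_of_integers: "cring (ring_of_integers :: 'k :: field_char_0 ring)"
proof (rule cringI)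
  show "abelian_group (ring_of_integers :: 'k ring)"
  proof (rule abelian_groupI)
    fix x :: 'k assume "x \<in> carrier ring_of_integers"
    then show "\<exists>y\<in>carrier ring_of_integers. y \<oplus>\<^bsub>ring_of_integers\<^esub> x = \<zero>\<^bsub>ring_of_integers\<^esub>"
      by (intro bexI[of _ "- x"]) (auto simp: ring_of_integers_def)
  qed (auto simp: ring_of_integers_def)
  show "Group.comm_monoid (ring_of_integers :: 'k ring)"
    by (rule comm_monoidI) (auto simp: ring_of_integers_def)
qed (auto simp: ring_of_integers_def algebra_simps)

lemma ideal_ring_of_integersI:
  fixes I :: "'k :: field_char_0 set"
  assumes sub: "\<And>x. x \<in> I \<Longrightarrow> algebraic_int x" and mem_0: "0 \<in> I"
    and add: "\<And>x y. x \<in> I \<Longrightarrow> y \<in> I \<Longrightarrow> x + y \<in> I"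
    and mult: "\<And>x r. x \<in> I \<Longrightarrow> algebraic_int r \<Longrightarrow> r * x \<in> I"
  shows "ideal I ring_of_integers"
proof -
  interpret cring "ring_of_integers :: 'k ring"
    by (rule cring_ring_of_integers)
  have neg: "inv\<^bsub>add_monoid ring_of_integers\<^esub> x = - x" if "algebraic_int x" for x :: 'k
    using minus_equality[of "- x" x] that by (simp add: a_inv_def ring_of_integers_def)
  show ?thesis
  proof (rule idealI)
    show "ring (ring_of_integers :: 'k ring)"
      by (rule ring_axioms)
    show "subgroup I (add_monoid ring_of_integers)"
    proof
      show "inv\<^bsub>add_monoid ring_of_integers\<^esub> x \<in> I" if "x \<in> I" for x
        using mult[OF that, of "- 1"] unfolding neg[OF sub[OF that]] by simp
    qed (use sub mem_0 add in \<open>auto simp: ring_of_integers_def\<close>)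
  qed (use mult in \<open>auto simp: ring_of_integers_def mult.commute\<close>)
qed

text \<open>Take \<open>d\<close> among the multiples of \<open>a\<close> outside \<open>pO\<close> such that \<open>P = {r. r d \<in> pO}\<close> is
  maximal, hence prime, and put \<open>x = d / p\<close>. As \<open>x\<close> is not integral, \<open>x P\<close> is not contained in \<open>P\<close>,
  so \<open>P (O + x O) = O\<close>; and \<open>p (O + x O)\<^sup>2 \<subseteq> O\<close> because \<open>d\<^sup>2 \<in> pO\<close>.\<close>

lemma ramified_in_if_nilpotent_residue:
  fixes a :: "'k :: field_char_0"
  assumes K: "number_field TYPE('k)" and p: "prime p"
    and a: "algebraic_int a" "algebraic_int (a\<^sup>2 / of_int p)" "\<not> algebraic_int (a / of_int p)"
  shows "ramified_in TYPE('k) p"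
proof -
  obtain S :: "'k set" where fin: "finite S"
    and S: "\<And>r. algebraic_int r \<Longrightarrow> \<exists>s\<in>S. algebraic_int ((r - s) / of_int p)"
    using finite_residues[OF K p] by blast
  define q :: 'k where "q = of_int p"
  have q0: "q \<noteq> 0" and qint: "algebraic_int q"
    using p by (auto simp: q_def)
  note [intro] = algebraic_int_add algebraic_int_mult algebraic_int_diff algebraic_int_power
  \<comment> \<open>There are finitely many residue classes modulo \<open>q\<close>, so some two
    terms of an integral sequence are congruent.\<close>
  have pigeonhole: "\<exists>k l. k < l \<and> algebraic_int ((f l - f k) / q)"
    if "\<And>k. algebraic_int (f k)" for f :: "nat \<Rightarrow> 'k"
  proof -
    have "\<forall>k. \<exists>s. s \<in> S \<and> algebraic_int ((f k - s) / q)"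
      using S that unfolding q_def by blast
    then obtain s where s: "\<And>k. s k \<in> S" "\<And>k. algebraic_int ((f k - s k) / q)"
      by metis
    have "\<not> inj_on s UNIV"
      using fin s(1) by (metis finite_imageD finite_subset image_subsetI infinite_UNIV_nat)
    then obtain k l where kl: "k < l" "s k = s l"
      by (metis injI linorder_neqE_nat)
    have "(f l - f k) / q = (f l - s l) / q - (f k - s k) / q"
      using kl(2) by (simp flip: diff_divide_distrib)
    then show ?thesis
      using kl(1) s(2) by (metis algebraic_int_diff)
  qed
  define cand where "cand = (\<lambda>c. algebraic_int c \<and> \<not> algebraic_int (c * a / q))"
  \<comment> \<open>The annihilator of \<open>c * a\<close> modulo \<open>q\<close> is determined by
    the representatives it contains, so a largest count gives a maximal annihilator.\<close>
  define f where "f = (\<lambda>c. card {s \<in> S. algebraic_int (c * a * s / q)})"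
  have "cand 1"
    using a by (simp add: cand_def q_def)
  moreover have "f c < Suc (card S)" for c
    unfolding f_def less_Suc_eq_le using fin by (intro card_mono) auto
  ultimately obtain c where c: "cand c" and max: "\<And>c'. cand c' \<Longrightarrow> f c' \<le> f c"
    using ex_has_greatest_nat[of cand 1 f "Suc (card S)"] by blast
  define d where "d = c * a"
  have d: "algebraic_int d" "\<not> algebraic_int (d / q)"
    using c a(1) by (auto simp: d_def cand_def)
  define e where "e = d\<^sup>2 / q"
  have qe: "q * e = d\<^sup>2"
    using q0 by (simp add: e_def)
  have "e = c\<^sup>2 * (a\<^sup>2 / q)"
    by (simp add: e_def d_def power_mult_distrib)
  moreover have "algebraic_int (c\<^sup>2 * (a\<^sup>2 / q))"
    using c a(2) unfolding cand_def q_def by (intro algebraic_int_mult algebraic_int_power) auto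
  ultimately have d2: "algebraic_int e"
    by (simp only:)
  define P where "P = {r. algebraic_int r \<and> algebraic_int (r * d / q)}"
  have P_add: "r + s \<in> P" if "r \<in> P" "s \<in> P" for r s
    using that by (auto simp: P_def distrib_right add_divide_distrib)
  have P_mult: "s * r \<in> P" if "r \<in> P" "algebraic_int s" for r s
  proof -
    have "s * r * d / q = s * (r * d / q)"
      by simp
    then show ?thesis
      using that unfolding P_def by (metis (mono_tags, lifting) algebraic_int_mult mem_Collect_eq)
  qed
  have P_ideal: "ideal P ring_of_integers"
    using P_add P_mult by (intro ideal_ring_of_integersI) (auto simp: P_def)
  have P_1: "1 \<notin> P"
    using d(2) by (simp add: P_def)
  have P_q: "r \<in> P" if "algebraic_int r" "algebraic_int (r / q)" for r
    using that algebraic_int_mult[OF that(2) d(1)] by (simp add: P_def)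
  \<comment> \<open>For \<open>r\<close> outside \<open>P\<close>, \<open>r * c\<close> is again a
    candidate and its annihilator contains that of \<open>c\<close>. Maximality makes the two agree
    on \<open>S\<close>; as \<open>s\<close> annihilates \<open>r * c * a\<close> modulo
    \<open>q\<close>, so does its representative \<open>s'\<close>, which therefore annihilates
    \<open>d\<close>, and with it \<open>s\<close>.\<close>
  have P_prime: "s \<in> P" if r: "algebraic_int r" "r \<notin> P" and s: "algebraic_int s" and rs: "r * s \<in> P" for r s
  proof -
    let ?T = "\<lambda>c. {s \<in> S. algebraic_int (c * a * s / q)}"
    have "cand (r * c)"
      using r c by (auto simp: cand_def P_def d_def mult.assoc)
    then have "card (?T (r * c)) \<le> card (?T c)"
      using max by (simp add: f_def)
    moreover have "?T c \<subseteq> ?T (r * c)"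
    proof
      fix t assume t: "t \<in> ?T c"
      then have "algebraic_int (r * (c * a * t / q))"
        using r(1) by (intro algebraic_int_mult) auto
      moreover have "r * (c * a * t / q) = r * c * a * t / q"
        by (simp add: mult.assoc)
      ultimately have "algebraic_int (r * c * a * t / q)"
        by (simp only:)
      then show "t \<in> ?T (r * c)"
        using t by simp
    qed
    ultimately have T: "?T (r * c) = ?T c"
      using fin by (intro card_seteq[symmetric]) auto
    obtain s' where s': "s' \<in> S" "algebraic_int ((s - s') / q)"
      using S[OF s] unfolding q_def by blast
    have "r * c * a * s' / q = r * s * d / q - r * d * ((s - s') / q)"
      by (simp add: d_def algebra_simps diff_divide_distrib)
    also have "algebraic_int \<dots>"
      using rs s'(2) r(1) d(1) by (intro algebraic_int_diff algebraic_int_mult) (auto simp: P_def)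
    finally have "algebraic_int (r * c * a * s' / q)" .
    then have "algebraic_int (c * a * s' / q)"
      using T s'(1) by blast
    then have "algebraic_int (c * a * s' / q + d * ((s - s') / q))"
      using s'(2) d(1) by (intro algebraic_int_add algebraic_int_mult)
    also have "c * a * s' / q + d * ((s - s') / q) = s * d / q"
      by (simp add: d_def algebra_simps diff_divide_distrib)
    finally have "algebraic_int (s * d / q)" .
    then show ?thesis
      using s by (simp add: P_def)
  qed
  define x where "x = d / q"
  have xP_int: "algebraic_int (x * v)" if "v \<in> P" for v
    using that by (simp add: P_def x_def mult.commute)
  \<comment> \<open>If \<open>x\<close> mapped \<open>P\<close> into itself, all
    \<open>x ^ k * q\<close> would be integral. Two of them are congruent modulo \<open>q\<close>,
    so some \<open>x ^ l - x ^ k\<close> is integral, which makes \<open>x\<close> integral. The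
    pigeonhole principle stands in for finite generation of \<open>P\<close>.\<close>
  have "\<exists>v\<in>P. x * v \<notin> P"
  proof (rule ccontr)
    assume "\<not> (\<exists>v\<in>P. x * v \<notin> P)"
    then have stable: "x * v \<in> P" if "v \<in> P" for v
      using that by blast
    have "x ^ k * q \<in> P" for k
    proof (induction k)
      case 0
      show ?case
        using P_q[of q] qint q0 by simp
    next
      case (Suc k)
      then show ?case
        using stable[of "x ^ k * q"] by (simp add: mult.assoc)
    qed
    then have "algebraic_int (x ^ k * q)" for k
      by (simp add: P_def)
    then obtain k l where kl: "k < l" "algebraic_int ((x ^ l * q - x ^ k * q) / q)"
      using pigeonhole[of "\<lambda>k. x ^ k * q"] by blast
    then have diff: "algebraic_int (x ^ l - x ^ k)"
      using q0 by (simp add: diff_divide_distrib)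
    define m :: "'k poly" where "m = monom 1 l - monom 1 k"
    have deg: "degree m = l"
      using kl(1) degree_add_eq_left[of "- monom 1 k :: 'k poly" "monom 1 l"]
      by (simp add: m_def degree_monom_eq)
    have "algebraic_int x"
    proof (rule algebraic_int_root[OF diff])
      show "poly m x = x ^ l - x ^ k"
        by (simp add: m_def poly_monom)
      show "\<forall>i. coeff m i \<in> \<int>"
        by (simp add: m_def)
      show "lead_coeff m = 1" "degree m > 0"
        using kl(1) unfolding deg by (simp_all add: m_def)
    qed
    then show False
      using d(2) by (simp add: x_def)
  qed
  then obtain v where v: "v \<in> P" "x * v \<notin> P"
    by blast
  define w where "w = x * v"
  have w: "algebraic_int w" "w \<notin> P"
    using v xP_int by (auto simp: w_def)
  have w_pow: "w ^ k \<notin> P" for k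
  proof (induction k)
    case (Suc k)
    then show ?case
      using P_prime[of w "w ^ k"] w by auto
  qed (use P_1 in simp)
  obtain k l where kl: "k < l" "algebraic_int ((w ^ l - w ^ k) / q)"
    using pigeonhole[of "\<lambda>k. w ^ k"] w(1) by blast
  \<comment> \<open>The powers of \<open>w\<close> repeat modulo \<open>q\<close>, so
    \<open>w ^ k * u\<close> lies in qO and hence in \<open>P\<close>. Primality then puts
    \<open>u\<close> into \<open>P\<close>: \<open>w\<close> is a unit modulo
    \<open>P\<close>.\<close>
  define u where "u = 1 - w ^ (l - k)"
  have "w ^ k * u = w ^ k - w ^ l"
    using kl(1) by (simp add: u_def algebra_simps flip: power_add)
  then have "w ^ k * u / q = - ((w ^ l - w ^ k) / q)"
    by (simp add: minus_divide_left)
  then have "w ^ k * u \<in> P"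
    using kl(2) w(1) by (intro P_q) (auto simp: u_def)
  then have u: "u \<in> P"
    using w w_pow by (intro P_prime[of "w ^ k" u]) (auto simp: u_def)
  define v' where "v' = w ^ (l - k - 1) * v"
  have v': "v' \<in> P"
    unfolding v'_def using v(1) w(1) by (intro P_mult) auto
  have "w ^ (l - k) = w ^ (l - k - 1) * w"
    using kl(1) by (metis Suc_diff_1 power_Suc2 zero_less_diff)
  then have "1 = u + x * v'"
    by (simp add: u_def v'_def w_def)
  then have one: "q = q * u + d * v'"
    using q0 by (simp add: x_def field_simps)
  \<comment> \<open>This is q (O + xO)^2, with generators \<open>q\<close>, \<open>q * x = d\<close>
    and \<open>q * x^2 = e\<close>. It is the cofactor of P^2 in qO.\<close>
  define H where "H = {q * \<alpha> + d * \<beta> + e * \<gamma> | \<alpha> \<beta> \<gamma>. algebraic_int \<alpha> \<and> algebraic_int \<beta> \<and> algebraic_int \<gamma>}"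
  have H_I: "q * \<alpha> + d * \<beta> + e * \<gamma> \<in> H"
    if "algebraic_int \<alpha>" "algebraic_int \<beta>" "algebraic_int \<gamma>" for \<alpha> \<beta> \<gamma>
    using that unfolding H_def by blast
  have H_ideal: "ideal H ring_of_integers"
  proof (rule ideal_ring_of_integersI)
    show "algebraic_int h" if "h \<in> H" for h
      using that qint d(1) d2 unfolding H_def by (auto simp del: times_divide_eq_left)
    show "0 \<in> H"
      using H_I[of 0 0 0] by simp
    show "g + h \<in> H" if gh: "g \<in> H" "h \<in> H" for g h
    proof -
      obtain \<alpha> \<beta> \<gamma> \<alpha>' \<beta>' \<gamma>' where "g = q * \<alpha> + d * \<beta> + e * \<gamma>" "h = q * \<alpha>' + d * \<beta>' + e * \<gamma>'"
        and "algebraic_int \<alpha>" "algebraic_int \<beta>" "algebraic_int \<gamma>"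
          "algebraic_int \<alpha>'" "algebraic_int \<beta>'" "algebraic_int \<gamma>'"
        using gh unfolding H_def by blast
      then show ?thesis
        using H_I[of "\<alpha> + \<alpha>'" "\<beta> + \<beta>'" "\<gamma> + \<gamma>'"] by (auto simp: algebra_simps)
    qed
    show "r * h \<in> H" if h: "h \<in> H" "algebraic_int r" for h r
    proof -
      obtain \<alpha> \<beta> \<gamma> where "h = q * \<alpha> + d * \<beta> + e * \<gamma>"
        "algebraic_int \<alpha>" "algebraic_int \<beta>" "algebraic_int \<gamma>"
        using h unfolding H_def by blast
      then show ?thesis
        using H_I[of "r * \<alpha>" "r * \<beta>" "r * \<gamma>"] h(2) by (auto simp: algebra_simps)
    qed
  qed
  let ?R = "ring_of_integers :: 'k ring"
  let ?PP = "ideal_prod ?R P P"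
  \<comment> \<open>The products of \<open>g\<close> with the generators \<open>q\<close>,
    \<open>d\<close> and \<open>e\<close> of \<open>H\<close> all lie in qO. For \<open>e\<close>
    the quotient \<open>e / q\<close> is the square of \<open>d / q\<close>, so each of the two
    factors from \<open>P\<close> absorbs one \<open>d / q\<close>.\<close>
  have PP_dvd: "algebraic_int g \<and> algebraic_int (g * d / q) \<and> algebraic_int (g * e / q)" if "g \<in> ?PP" for g
    using that
  proof (induction g rule: ideal_prod.induct)
    case (prod i j)
    then have ij: "algebraic_int i" "algebraic_int j" "algebraic_int (i * d / q)" "algebraic_int (j * d / q)"
      by (auto simp: P_def)
    have eq: "i * j * d / q = i * (j * d / q)" "i * j * e / q = (i * d / q) * (j * d / q)"
      by (simp_all add: e_def power2_eq_square)
    have "algebraic_int (i * j)" "algebraic_int (i * j * d / q)" "algebraic_int (i * j * e / q)"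
      unfolding eq using ij by (intro algebraic_int_mult; simp)+
    then show ?case
      by (simp add: ring_of_integers_def)
  next
    case (sum s1 s2)
    then show ?case
      by (auto simp: ring_of_integers_def distrib_right add_divide_distrib)
  qed
  have "ideal_prod ?R ?PP H = cgenideal ?R q"
  proof
    show "ideal_prod ?R ?PP H \<subseteq> cgenideal ?R q"
    proof
      fix z assume "z \<in> ideal_prod ?R ?PP H"
      then have "algebraic_int (z / q)"
      proof (induction z rule: ideal_prod.induct)
        case (prod g h)
        then obtain \<alpha> \<beta> \<gamma> where h: "h = q * \<alpha> + d * \<beta> + e * \<gamma>"
          "algebraic_int \<alpha>" "algebraic_int \<beta>" "algebraic_int \<gamma>"
          unfolding H_def by blast
        have "g * h / q = g * \<alpha> + (g * d / q) * \<beta> + (g * e / q) * \<gamma>"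
          using q0 by (simp add: h(1) field_simps)
        also have "algebraic_int \<dots>"
          using PP_dvd[OF prod(1)] h(2-4) by (intro algebraic_int_add algebraic_int_mult) auto
        finally show ?case
          by (simp add: ring_of_integers_def)
      next
        case (sum s1 s2)
        then show ?case
          by (auto simp: ring_of_integers_def add_divide_distrib)
      qed
      then show "z \<in> cgenideal ?R q"
        unfolding cgenideal_def using q0
        by (auto simp: ring_of_integers_def intro!: exI[of _ "z / q"])
    qed
    show "cgenideal ?R q \<subseteq> ideal_prod ?R ?PP H"
    proof
      fix z assume "z \<in> cgenideal ?R q"
      then obtain r where r: "algebraic_int r" "z = r * q"
        by (auto simp: cgenideal_def ring_of_integers_def)
      have PP: "i * j \<in> ?PP" if "i \<in> P" "j \<in> P" for i j
        using ideal_prod.prod[OF that, of ?R] by (simp add: ring_of_integers_def)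
      have prod: "g * h \<in> ideal_prod ?R ?PP H" if "g \<in> ?PP" "h \<in> H" for g h
        using ideal_prod.prod[OF that, of ?R] by (simp add: ring_of_integers_def)
      have plus: "g + h \<in> ideal_prod ?R ?PP H" if "g \<in> ideal_prod ?R ?PP H" "h \<in> ideal_prod ?R ?PP H" for g h
        using ideal_prod.sum[OF that] by (simp add: ring_of_integers_def)
      have H: "q * r \<in> H" "d * (2 * r) \<in> H" "e * r \<in> H"
        using H_I[of r 0 0] H_I[of 0 "2 * r" 0] H_I[of 0 0 r] r(1) by auto
      \<comment> \<open>The equation \<open>one\<close> is squared, using
        \<open>d^2 = q * e\<close>; cancelling \<open>q\<close> then writes \<open>z\<close> through
        products of elements of P^2 and \<open>H\<close>.\<close>
      have "q * z = q * ((u * u) * (q * r) + (u * v') * (d * (2 * r)) + (v' * v') * (e * r))"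
      proof -
        have "q * z = r * ((q * u + d * v') * (q * u + d * v'))"
          using one r(2) by simp
        also have "\<dots> = r * (q * q * (u * u) + 2 * q * d * (u * v') + d\<^sup>2 * (v' * v'))"
          by (simp add: algebra_simps power2_eq_square)
        also have "\<dots> = q * ((u * u) * (q * r) + (u * v') * (d * (2 * r)) + (v' * v') * (e * r))"
          unfolding qe[symmetric] by (simp add: algebra_simps)
        finally show ?thesis .
      qed
      then have "z = (u * u) * (q * r) + (u * v') * (d * (2 * r)) + (v' * v') * (e * r)"
        using q0 by (simp only: mult_cancel_left) simp
      then show "z \<in> ideal_prod ?R ?PP H"
        using PP u v' H by (simp only: plus prod)
    qed
  qed
  then have "ideal_divides ?R ?PP (cgenideal ?R q)"
    unfolding ideal_divides_def using H_ideal by blast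
  moreover have "primeideal P ?R"
  proof (rule primeidealI[OF P_ideal cring_ring_of_integers])
    show "carrier ?R \<noteq> P"
      using P_1 by (auto simp: ring_of_integers_def)
    show "r \<in> P \<or> s \<in> P"
      if "r \<in> carrier ?R" "s \<in> carrier ?R" "r \<otimes>\<^bsub>?R\<^esub> s \<in> P" for r s
      using P_prime[of r s] that by (simp add: ring_of_integers_def) blast
  qed
  moreover have "P \<noteq> {0}"
    using P_q[of q] qint q0 by auto
  ultimately show ?thesis
    unfolding ramified_in_def q_def by blast
qed

section \<open>Minors of the adjugate\<close>

text \<open>Laplace expansion along column \<open>k\<close>, whose cofactors do not see the replaced
  column.\<close>

lemma det_replace_col_smult:
  fixes A :: "'a :: comm_ring_1 mat"
  assumes A: "A \<in> carrier_mat n n" and k: "k < n" and v: "v \<in> carrier_vec n"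
  shows "det (replace_col A (c \<cdot>\<^sub>v v) k) = c * det (replace_col A v k)"
proof -
  have carr: "replace_col A w k \<in> carrier_mat n n" for w
    using A by (simp add: replace_col_def)
  have cof: "cofactor (replace_col A (c \<cdot>\<^sub>v v) k) i k = cofactor (replace_col A v k) i k" for i
    unfolding cofactor_def replace_col_def mat_delete_def
    by (intro arg_cong2[of _ _ _ _ "(*)"] arg_cong[of _ _ det] eq_matI) auto
  show ?thesis
    unfolding laplace_expansion_column[OF carr k] sum_distrib_left cof
    by (rule sum.cong) (use A k v in \<open>auto simp: replace_col_def mult.assoc\<close>)
qed

text \<open>Replacing column \<open>i\<close> of \<open>A\<close> by the unit vector \<open>e\<^sub>k\<close> gives a matrix \<open>A'\<close> of determinant
  \<open>(adj A)\<^sub>i\<^sub>k\<close>. Cramer's rule for \<open>A'\<close> is then applied to a vector \<open>y\<close> whose \<open>j\<close>-th entry is the minor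
  and for which \<open>A' y\<close> is a multiple of \<open>det A * e\<^sub>l\<close>.\<close>

lemma adj_mat_minor_dvd_aux:
  fixes A :: "'a :: idom mat"
  assumes A: "A \<in> carrier_mat n n" and D: "det A \<noteq> 0"
    and idx: "i < n" "j < n" "k < n" "l < n" and "i \<noteq> j" and nz: "adj_mat A $$ (i, k) \<noteq> 0"
  shows "det A dvd adj_mat A $$ (i, k) * adj_mat A $$ (j, l) - adj_mat A $$ (i, l) * adj_mat A $$ (j, k)"
proof -
  define B where "B = adj_mat A"
  define D where "D = det A"
  define u w where "u = col B k" and "w = col B l"
  have B: "B \<in> carrier_mat n n"
    using adj_mat[OF A] by (simp add: B_def)
  have uw: "u \<in> carrier_vec n" "w \<in> carrier_vec n"
    using B by (auto simp: u_def w_def)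
  have colB: "A *\<^sub>v col B m = D \<cdot>\<^sub>v unit_vec n m" if "m < n" for m
  proof -
    have "A *\<^sub>v col B m = col (A * B) m"
      using col_mult2[OF A B that] by simp
    also have "A * B = D \<cdot>\<^sub>m 1\<^sub>m n"
      unfolding B_def D_def by (rule adj_mat(2)[OF A])
    finally show ?thesis
      using that by simp
  qed
  have Au: "A *\<^sub>v u = D \<cdot>\<^sub>v unit_vec n k" and Aw: "A *\<^sub>v w = D \<cdot>\<^sub>v unit_vec n l"
    using colB idx by (auto simp: u_def w_def)
  define A' where "A' = replace_col A (unit_vec n k) i"
  have A': "A' \<in> carrier_mat n n"
    using A by (simp add: A'_def replace_col_def)
  have "D * det A' = vec_index u i * D"
    using cramer_lemma_mat[OF A uw(1) idx(1)] det_replace_col_smult[OF A idx(1), of "unit_vec n k" D]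
    by (auto simp: A'_def Au D_def)
  then have detA': "det A' = vec_index u i"
    using D by (auto simp: D_def mult.commute)
  \<comment> \<open>The vector \<open>u_i w - w_i u\<close> has entry 0 at \<open>i\<close>, and
    \<open>A\<close> maps it to \<open>D (u_i e_l - w_i e_k)\<close>. Since column \<open>i\<close>
    of \<open>A'\<close> is \<open>e_k\<close>, the extra entry \<open>D w_i\<close> at
    \<open>i\<close> cancels the unwanted \<open>e_k\<close>.\<close>
  define y where "y = vec n (\<lambda>r. vec_index u i * vec_index w r - vec_index w i * vec_index u r
    + (if r = i then D * vec_index w i else 0))"
  have y: "y \<in> carrier_vec n"
    by (simp add: y_def)
  have "A' *\<^sub>v y = (D * vec_index u i) \<cdot>\<^sub>v unit_vec n l"
  proof (rule eq_vecI)
    fix r assume "r < dim_vec ((D * vec_index u i) \<cdot>\<^sub>v unit_vec n l)"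
    then have r: "r < n"
      by simp
    have Au_r: "(\<Sum>s = 0..<n. A $$ (r, s) * vec_index u s) = D * vec_index (unit_vec n k) r"
      using arg_cong[OF Au, of "\<lambda>v. vec_index v r"] r A uw by (simp add: scalar_prod_def)
    have Aw_r: "(\<Sum>s = 0..<n. A $$ (r, s) * vec_index w s) = D * vec_index (unit_vec n l) r"
      using arg_cong[OF Aw, of "\<lambda>v. vec_index v r"] r A uw by (simp add: scalar_prod_def)
    have "vec_index (A' *\<^sub>v y) r = (\<Sum>s = 0..<n. A' $$ (r, s) * vec_index y s)"
      using r A' y by (simp add: scalar_prod_def)
    also have "\<dots> = (\<Sum>s = 0..<n. vec_index u i * (A $$ (r, s) * vec_index w s)
        - vec_index w i * (A $$ (r, s) * vec_index u s)
        + (if s = i then vec_index (unit_vec n k) r * (D * vec_index w i) else 0))"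
      by (rule sum.cong) (use r A idx in \<open>auto simp: A'_def replace_col_def y_def algebra_simps\<close>)
    also have "\<dots> = vec_index u i * (D * vec_index (unit_vec n l) r)
        - vec_index w i * (D * vec_index (unit_vec n k) r)
        + vec_index (unit_vec n k) r * (D * vec_index w i)"
      using idx by (simp add: sum.distrib sum_subtractf Au_r Aw_r sum.delta flip: sum_distrib_left)
    also have "\<dots> = vec_index ((D * vec_index u i) \<cdot>\<^sub>v unit_vec n l) r"
      using r by (simp add: algebra_simps)
    finally show "vec_index (A' *\<^sub>v y) r = vec_index ((D * vec_index u i) \<cdot>\<^sub>v unit_vec n l) r" .
  qed (use A' in simp)
  \<comment> \<open>Cramer's rule for \<open>A'\<close> at index \<open>j\<close>; the entry
    \<open>j\<close> of \<open>y\<close> is the minor because \<open>j\<close> differs from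
    \<open>i\<close>. Both sides carry the factor \<open>u_i\<close>, which is nonzero and
    cancels.\<close>
  then have "vec_index u i * (D * det (replace_col A' (unit_vec n l) j)) =
      vec_index u i * (vec_index u i * vec_index w j - vec_index w i * vec_index u j)"
    using cramer_lemma_mat[OF A' y idx(2)] \<open>i \<noteq> j\<close> idx
      det_replace_col_smult[OF A' idx(2), of "unit_vec n l" "D * vec_index u i"]
    by (simp add: detA' y_def algebra_simps)
  moreover have "vec_index u i \<noteq> 0"
    using nz idx B by (simp add: u_def B_def)
  ultimately have "D * det (replace_col A' (unit_vec n l) j) =
      vec_index u i * vec_index w j - vec_index w i * vec_index u j"
    by simp
  then have "D dvd vec_index u i * vec_index w j - vec_index w i * vec_index u j"
    by (metis dvd_triv_left)
  then show ?thesis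
    using idx B by (simp add: u_def w_def B_def D_def)
qed

text \<open>If the entry \<open>(i, k)\<close> vanishes but \<open>(i, l)\<close> does not,
  exchanging \<open>k\<close> and \<open>l\<close> only changes the sign. In the other new cases the
  minor is 0.\<close>

lemma adj_mat_minor_dvd:
  fixes A :: "'a :: idom mat"
  assumes A: "A \<in> carrier_mat n n" and D: "det A \<noteq> 0"
    and idx: "i < n" "j < n" "k < n" "l < n"
  shows "det A dvd adj_mat A $$ (i, k) * adj_mat A $$ (j, l) - adj_mat A $$ (i, l) * adj_mat A $$ (j, k)"
proof -
  consider "i = j" | "i \<noteq> j" "adj_mat A $$ (i, k) \<noteq> 0" | "i \<noteq> j" "adj_mat A $$ (i, l) \<noteq> 0"
    | "adj_mat A $$ (i, k) = 0" "adj_mat A $$ (i, l) = 0"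
    by blast
  then show ?thesis
  proof cases
    case 1
    then show ?thesis
      by (simp add: mult.commute[of "adj_mat A $$ (j, k)"])
  next
    case 2
    then show ?thesis
      using adj_mat_minor_dvd_aux[OF A D] idx by blast
  next
    case 3
    then show ?thesis
      using adj_mat_minor_dvd_aux[OF A D, of i j l k] idx
      by (metis dvd_minus_iff minus_diff_eq)
  qed simp
qed

text \<open>Both \<open>adj_mat A\<close> and its transpose are sent by \<open>A\<close> to
  \<open>det A\<close> times the identity. Multiplying by \<open>adj_mat A\<close> compares them up
  to the factor \<open>det A\<close>, which cancels.\<close>

lemma adj_mat_symmetric:
  fixes A :: "'a :: idom mat"
  assumes A: "A \<in> carrier_mat n n" and "transpose_mat A = A" and D: "det A \<noteq> 0"
  shows "transpose_mat (adj_mat A) = adj_mat A"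
proof -
  note adj = adj_mat[OF A]
  have T: "transpose_mat (adj_mat A) \<in> carrier_mat n n"
    using adj(1) by simp
  have "A * transpose_mat (adj_mat A) = transpose_mat (adj_mat A * A)"
    using transpose_mult[OF adj(1) A] assms(2) by simp
  also have "\<dots> = det A \<cdot>\<^sub>m 1\<^sub>m n"
    unfolding adj(3) by (rule eq_matI) auto
  finally have *: "A * transpose_mat (adj_mat A) = det A \<cdot>\<^sub>m 1\<^sub>m n" .
  have "det A \<cdot>\<^sub>m transpose_mat (adj_mat A) = (adj_mat A * A) * transpose_mat (adj_mat A)"
    using T by (simp add: adj(3) mult_smult_assoc_mat[of _ n n])
  also have "\<dots> = adj_mat A * (A * transpose_mat (adj_mat A))"
    using adj(1) A T by (rule assoc_mult_mat)
  also have "\<dots> = det A \<cdot>\<^sub>m adj_mat A"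
    unfolding * using adj(1) by (simp add: mult_smult_distrib[OF adj(1) one_carrier_mat])
  finally have eq: "det A \<cdot>\<^sub>m transpose_mat (adj_mat A) = det A \<cdot>\<^sub>m adj_mat A" .
  show ?thesis
  proof (rule eq_matI)
    fix i j assume ij: "i < dim_row (adj_mat A)" "j < dim_col (adj_mat A)"
    then have "det A * transpose_mat (adj_mat A) $$ (i, j) = det A * adj_mat A $$ (i, j)"
      using arg_cong[OF eq, of "\<lambda>M. M $$ (i, j)"] adj(1) T by simp
    then show "transpose_mat (adj_mat A) $$ (i, j) = adj_mat A $$ (i, j)"
      using D by simp
  qed (use adj(1) in auto)
qed

section \<open>Polynomials at a matrix\<close>

lemma poly_eval_mat_dim [simp]:
  "dim_row (poly_eval_mat p A) = dim_row A" "dim_col (poly_eval_mat p A) = dim_row A"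
  by (simp_all add: poly_eval_mat_def)

lemma poly_eval_mat_carrier [simp, intro]:
  "A \<in> carrier_mat n n \<Longrightarrow> poly_eval_mat p A \<in> carrier_mat n n"
  by (intro carrier_matI) simp_all

lemma poly_eval_mat_index:
  assumes "A \<in> carrier_mat n n" "i < n" "j < n" "degree p \<le> N"
  shows "poly_eval_mat p A $$ (i, j) = (\<Sum>k\<le>N. coeff p k * (A ^\<^sub>m k) $$ (i, j))"
proof -
  have "(\<Sum>k\<le>degree p. coeff p k * (A ^\<^sub>m k) $$ (i, j)) = (\<Sum>k\<le>N. coeff p k * (A ^\<^sub>m k) $$ (i, j))"
    by (rule sum.mono_neutral_left) (use assms(4) in \<open>auto simp: coeff_eq_0\<close>)
  then show ?thesis
    using assms by (simp add: poly_eval_mat_def)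
qed

lemma poly_eval_mat_0: "A \<in> carrier_mat n n \<Longrightarrow> poly_eval_mat 0 A = 0\<^sub>m n n"
  by (rule eq_matI) (auto simp: poly_eval_mat_def)

text \<open>Horner's rule, on which the inductions over polynomials rest.\<close>

lemma poly_eval_mat_pCons:
  assumes A: "A \<in> carrier_mat n n"
  shows "poly_eval_mat (pCons c p) A = c \<cdot>\<^sub>m 1\<^sub>m n + poly_eval_mat p A * A"
proof (rule eq_matI)
  fix i j
  assume "i < dim_row (c \<cdot>\<^sub>m 1\<^sub>m n + poly_eval_mat p A * A)"
    and "j < dim_col (c \<cdot>\<^sub>m 1\<^sub>m n + poly_eval_mat p A * A)"
  then have ij: "i < n" "j < n"
    using A by auto
  let ?N = "degree p"
  have "poly_eval_mat (pCons c p) A $$ (i, j) = (\<Sum>k\<le>Suc ?N. coeff (pCons c p) k * (A ^\<^sub>m k) $$ (i, j))"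
    using poly_eval_mat_index[OF A ij] degree_pCons_le by blast
  also have "\<dots> = c * 1\<^sub>m n $$ (i, j) + (\<Sum>k\<le>?N. coeff p k * (A ^\<^sub>m k * A) $$ (i, j))"
    using A by (simp add: sum.atMost_Suc_shift del: sum.atMost_Suc)
  also have "(\<Sum>k\<le>?N. coeff p k * (A ^\<^sub>m k * A) $$ (i, j)) =
      (\<Sum>k\<le>?N. \<Sum>s = 0..<n. coeff p k * (A ^\<^sub>m k) $$ (i, s) * A $$ (s, j))"
    using A ij by (intro sum.cong) (simp_all add: scalar_prod_def sum_distrib_left mult.assoc)
  also have "\<dots> = (\<Sum>s = 0..<n. poly_eval_mat p A $$ (i, s) * A $$ (s, j))"
    using ij by (subst sum.swap) (simp add: poly_eval_mat_index[OF A, of i _ p ?N] sum_distrib_right)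
  also have "\<dots> = (poly_eval_mat p A * A) $$ (i, j)"
    using A ij by (simp add: scalar_prod_def)
  finally show "poly_eval_mat (pCons c p) A $$ (i, j) = (c \<cdot>\<^sub>m 1\<^sub>m n + poly_eval_mat p A * A) $$ (i, j)"
    using A ij by simp
qed (use A in auto)

lemma poly_eval_mat_sum_index:
  assumes A: "A \<in> carrier_mat n n" and ij: "i < n" "j < n" and "finite I"
  shows "poly_eval_mat (\<Sum>m\<in>I. p m) A $$ (i, j) = (\<Sum>m\<in>I. poly_eval_mat (p m) A $$ (i, j))"
proof -
  define N where "N = Max (insert (degree (\<Sum>m\<in>I. p m)) ((\<lambda>m. degree (p m)) ` I))"
  have N: "degree (\<Sum>m\<in>I. p m) \<le> N" "m \<in> I \<Longrightarrow> degree (p m) \<le> N" for m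
    unfolding N_def using \<open>finite I\<close> by (auto intro: Max_ge)
  have "poly_eval_mat (\<Sum>m\<in>I. p m) A $$ (i, j) = (\<Sum>k\<le>N. \<Sum>m\<in>I. coeff (p m) k * (A ^\<^sub>m k) $$ (i, j))"
    by (simp add: poly_eval_mat_index[OF A ij N(1)] coeff_sum sum_distrib_right)
  also have "\<dots> = (\<Sum>m\<in>I. poly_eval_mat (p m) A $$ (i, j))"
    by (subst sum.swap) (simp add: poly_eval_mat_index[OF A ij N(2)])
  finally show ?thesis .
qed

text \<open>Moves a polynomial in \<open>X\<close> across \<open>Q\<close> in
  \<open>X Q = Q Y\<close>; with all three matrices equal it says that \<open>A\<close> commutes
  with its polynomials.\<close>

lemma poly_eval_mat_intertwine:
  fixes A B Q :: "'a :: comm_ring_1 mat"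
  assumes A: "A \<in> carrier_mat n n" and B: "B \<in> carrier_mat n n" and Q: "Q \<in> carrier_mat n n"
    and eq: "A * Q = Q * B"
  shows "poly_eval_mat p A * Q = Q * poly_eval_mat p B"
proof (induction p)
  case 0
  then show ?case
    using Q by (simp add: poly_eval_mat_0[OF A] poly_eval_mat_0[OF B])
next
  case (pCons c p)
  let ?E = "poly_eval_mat p A" and ?F = "poly_eval_mat p B"
  note carr = poly_eval_mat_carrier[OF A, of p] poly_eval_mat_carrier[OF B, of p]
  have "poly_eval_mat (pCons c p) A * Q = c \<cdot>\<^sub>m Q + ?E * A * Q"
    unfolding poly_eval_mat_pCons[OF A] using A Q carr
    by (subst add_mult_distrib_mat[of _ n n]) (simp_all add: mult_carrier_mat[of _ n n] mult_smult_assoc_mat[of _ n n])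
  also have "?E * A * Q = ?E * (A * Q)"
    using carr(1) A Q by (rule assoc_mult_mat)
  also have "\<dots> = ?E * Q * B"
    unfolding eq using carr(1) Q B by (rule assoc_mult_mat[symmetric])
  also have "\<dots> = Q * (?F * B)"
    unfolding pCons using Q carr(2) B by (rule assoc_mult_mat)
  also have "c \<cdot>\<^sub>m Q + Q * (?F * B) = Q * poly_eval_mat (pCons c p) B"
    unfolding poly_eval_mat_pCons[OF B] using B Q carr
    by (subst mult_add_distrib_mat[of _ n n _ n]) (simp_all add: mult_carrier_mat[of _ n n] mult_smult_distrib[OF Q one_carrier_mat])
  finally show ?case .
qed

lemma poly_eval_mat_symmetric:
  fixes A :: "'a :: comm_ring_1 mat"
  assumes A: "A \<in> carrier_mat n n" and sym: "transpose_mat A = A"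
  shows "transpose_mat (poly_eval_mat p A) = poly_eval_mat p A"
proof (induction p)
  case 0
  show ?case
    by (simp add: poly_eval_mat_0[OF A])
next
  case (pCons c p)
  let ?E = "poly_eval_mat p A"
  note carr = poly_eval_mat_carrier[OF A, of p]
  have "transpose_mat (?E * A) = A * ?E"
    using transpose_mult[OF carr A] sym pCons by simp
  also have "\<dots> = ?E * A"
    using poly_eval_mat_intertwine[OF A A A refl] by simp
  finally have "transpose_mat (?E * A) = ?E * A" .
  moreover have "transpose_mat (c \<cdot>\<^sub>m 1\<^sub>m n) = c \<cdot>\<^sub>m 1\<^sub>m n"
    by (rule eq_matI) auto
  ultimately show ?case
    unfolding poly_eval_mat_pCons[OF A] using A carr
    by (subst transpose_add[of _ n n]) (simp_all add: mult_carrier_mat[of _ n n])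
qed

lemma (in comm_ring_hom) poly_eval_mat_hom:
  assumes A: "A \<in> carrier_mat n n"
  shows "map_mat hom (poly_eval_mat p A) = poly_eval_mat (map_poly hom p) (map_mat hom A)"
proof (induction p)
  case 0
  have "map_mat hom A \<in> carrier_mat n n"
    using A by simp
  moreover have "map_mat hom (0\<^sub>m n n) = 0\<^sub>m n n"
    by (rule eq_matI) auto
  ultimately show ?case
    by (simp add: poly_eval_mat_0[OF A] poly_eval_mat_0[of _ n])
next
  case (pCons c p)
  have hA: "map_mat hom A \<in> carrier_mat n n"
    using A by simp
  have "map_mat hom (poly_eval_mat (pCons c p) A) =
      map_mat hom (c \<cdot>\<^sub>m 1\<^sub>m n) + map_mat hom (poly_eval_mat p A * A)"
    unfolding poly_eval_mat_pCons[OF A] using A by (intro eq_matI) (auto simp: hom_distribs)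
  also have "map_mat hom (c \<cdot>\<^sub>m 1\<^sub>m n) = hom c \<cdot>\<^sub>m 1\<^sub>m n"
    by (rule eq_matI) (auto simp: hom_distribs)
  also have "map_mat hom (poly_eval_mat p A * A) = poly_eval_mat (map_poly hom p) (map_mat hom A) * map_mat hom A"
    using mat_hom_mult[OF poly_eval_mat_carrier[OF A, of p] A] pCons.IH by simp
  also have "hom c \<cdot>\<^sub>m 1\<^sub>m n + \<dots> = poly_eval_mat (map_poly hom (pCons c p)) (map_mat hom A)"
    using pCons.hyps by (simp add: poly_eval_mat_pCons[OF hA] map_poly_pCons)
  finally show ?case .
qed

section \<open>The adjugate of x - A and the derivative of the characteristic polynomial\<close>

lemma poly_altdef_le:
  fixes p :: "'a :: comm_semiring_1 poly"
  assumes "degree p \<le> N"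
  shows "poly p x = (\<Sum>k\<le>N. coeff p k * x ^ k)"
  unfolding poly_altdef by (rule sum.mono_neutral_left) (use assms in \<open>auto simp: coeff_eq_0\<close>)

text \<open>The coefficients of the quotient of \<open>p\<close> by x - a are the intermediate
  values of Horner's scheme at \<open>a\<close>.\<close>

lemma coeff_synthetic_div: "coeff (synthetic_div p a) l = poly (poly_shift (Suc l) p) a"
proof (induction p arbitrary: l)
  case (pCons c p)
  have "poly_shift (Suc l) (pCons c p) = poly_shift l p"
    by (rule poly_eqI) (simp add: coeff_poly_shift)
  then show ?case
    using pCons.IH by (cases l) simp_all
qed simp

text \<open>Comparing coefficients of \<open>x\<close> in \<open>adj (x - A) * (x - A) = \<chi>(x)\<close> gives the Horner recursion
  that the right-hand sides satisfy; both sides vanish for large \<open>k\<close>.\<close>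

lemma coeff_adj_char_poly_matrix:
  fixes A :: "'a :: comm_ring_1 mat"
  assumes A: "A \<in> carrier_mat n n" and ij: "i < n" "j < n"
  shows "coeff (adj_mat (char_poly_matrix A) $$ (i, j)) k =
    poly_eval_mat (poly_shift (Suc k) (char_poly A)) A $$ (i, j)"
proof -
  define M where "M = char_poly_matrix A"
  define N where "N = adj_mat M"
  define f where "f = char_poly A"
  have M: "M \<in> carrier_mat n n"
    using A by (simp add: M_def)
  have N: "N \<in> carrier_mat n n" and NM: "N * M = f \<cdot>\<^sub>m 1\<^sub>m n"
    using adj_mat[OF M] by (simp_all add: N_def f_def char_poly_def M_def)
  have rec: "coeff (N $$ (i, j)) k = (if i = j then coeff f (Suc k) else 0)
      + (\<Sum>s = 0..<n. coeff (N $$ (i, s)) (Suc k) * A $$ (s, j))"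
    if ij: "i < n" "j < n" for i j k
  proof -
    have "(if i = j then f else 0) = (N * M) $$ (i, j)"
      using ij by (simp add: NM)
    also have "\<dots> = (\<Sum>s = 0..<n. N $$ (i, s) * M $$ (s, j))"
      using M N ij by (simp add: scalar_prod_def)
    also have "\<dots> = (\<Sum>s = 0..<n. (if s = j then pCons 0 (N $$ (i, s)) else 0) - smult (A $$ (s, j)) (N $$ (i, s)))"
      using A ij by (intro sum.cong) (auto simp: M_def char_poly_matrix_def algebra_simps)
    also have "\<dots> = pCons 0 (N $$ (i, j)) - (\<Sum>s = 0..<n. smult (A $$ (s, j)) (N $$ (i, s)))"
      using ij by (simp add: sum_subtractf sum.delta)
    finally have "coeff (if i = j then f else 0) (Suc k) =
        coeff (N $$ (i, j)) k - (\<Sum>s = 0..<n. A $$ (s, j) * coeff (N $$ (i, s)) (Suc k))"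
      by (simp add: coeff_sum)
    then show ?thesis
      by (simp add: mult.commute split: if_splits)
  qed
  define K where "K = Max (insert (degree f) ((\<lambda>(i, j). degree (N $$ (i, j))) ` ({..<n} \<times> {..<n})))"
  have degf: "degree f \<le> K"
    unfolding K_def by (rule Max_ge) auto
  have degN: "degree (N $$ (i, j)) \<le> K" if "i < n" "j < n" for i j
    unfolding K_def using that by (intro Max_ge) auto
  \<comment> \<open>Downward induction on \<open>k\<close>: the counter \<open>d\<close> measures
    how far \<open>k\<close> may lie below the degree bound \<open>K\<close>.\<close>
  have "coeff (N $$ (i, j)) k = poly_eval_mat (poly_shift (Suc k) f) A $$ (i, j)"
    if "K < k + d" "i < n" "j < n" for d k i j
    using that
  proof (induction d arbitrary: k i j)
    case 0
    have "poly_shift (Suc k) f = 0"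
      using degf 0 by (intro poly_eqI) (simp add: coeff_poly_shift coeff_eq_0)
    moreover have "coeff (N $$ (i, j)) k = 0"
      using degN[of i j] 0 by (intro coeff_eq_0) auto
    ultimately show ?case
      using 0 by (simp add: poly_eval_mat_0[OF A])
  next
    case (Suc d)
    let ?E = "poly_eval_mat (poly_shift (Suc (Suc k)) f) A"
    have shift: "poly_shift (Suc k) f = pCons (coeff f (Suc k)) (poly_shift (Suc (Suc k)) f)"
      by (rule poly_eqI) (simp add: coeff_poly_shift coeff_pCons split: nat.split)
    have E: "?E \<in> carrier_mat n n"
      using A by simp
    have "poly_eval_mat (poly_shift (Suc k) f) A $$ (i, j) =
        (if i = j then coeff f (Suc k) else 0) + (\<Sum>s = 0..<n. ?E $$ (i, s) * A $$ (s, j))"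
      unfolding shift poly_eval_mat_pCons[OF A] using A E Suc.prems by (simp add: scalar_prod_def)
    also have "(\<Sum>s = 0..<n. ?E $$ (i, s) * A $$ (s, j)) =
        (\<Sum>s = 0..<n. coeff (N $$ (i, s)) (Suc k) * A $$ (s, j))"
      using Suc.prems Suc.IH[of "Suc k" i] by (intro sum.cong) simp_all
    finally show ?case
      using rec[OF Suc.prems(2,3), of k] by simp
  qed
  from this[of k "Suc K"] show ?thesis
    using ij by (simp add: N_def M_def f_def)
qed

text \<open>Both sides are the sum of f_(k+l+1) a^k A^l over all \<open>k\<close> and
  \<open>l\<close>, grouped by powers of \<open>a\<close> on the left and by powers of
  \<open>A\<close> on the right.\<close>

lemma poly_adj_char_poly_matrix:
  fixes A :: "'a :: comm_ring_1 mat"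
  assumes A: "A \<in> carrier_mat n n" and ij: "i < n" "j < n"
  shows "poly (adj_mat (char_poly_matrix A) $$ (i, j)) a =
    poly_eval_mat (synthetic_div (char_poly A) a) A $$ (i, j)"
proof -
  let ?N = "adj_mat (char_poly_matrix A) $$ (i, j)"
  define f where "f = char_poly A"
  define K where "K = degree f + degree ?N"
  have deg: "degree (poly_shift m f) \<le> K" for m
    by (rule degree_le) (auto simp: coeff_poly_shift coeff_eq_0 K_def)
  have "poly ?N a = (\<Sum>k\<le>K. coeff ?N k * a ^ k)"
    by (rule poly_altdef_le) (simp add: K_def)
  also have "\<dots> = (\<Sum>k\<le>K. \<Sum>l\<le>K. coeff f (l + Suc k) * (A ^\<^sub>m l) $$ (i, j) * a ^ k)"
    by (simp add: coeff_adj_char_poly_matrix[OF A ij] poly_eval_mat_index[OF A ij deg]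
        coeff_poly_shift sum_distrib_right flip: f_def)
  also have "\<dots> = (\<Sum>l\<le>K. \<Sum>k\<le>K. coeff f (k + Suc l) * a ^ k * (A ^\<^sub>m l) $$ (i, j))"
    by (subst sum.swap) (simp add: add.commute mult.commute mult.left_commute)
  also have "\<dots> = (\<Sum>l\<le>K. coeff (synthetic_div f a) l * (A ^\<^sub>m l) $$ (i, j))"
    by (simp add: coeff_synthetic_div poly_altdef_le[OF deg] coeff_poly_shift sum_distrib_right)
  also have "\<dots> = poly_eval_mat (synthetic_div f a) A $$ (i, j)"
    by (rule poly_eval_mat_index[OF A ij, symmetric]) (simp add: degree_synthetic_div K_def)
  finally show ?thesis
    by (simp add: f_def)
qed

text \<open>The minors are taken over the polynomial ring, where x - A has the nonzero determinant
  \<open>char_poly A\<close>. This divides the 2x2 minors of the adjugate, so they vanish at its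
  root \<open>a\<close>, although a - A itself is singular.\<close>

lemma synthetic_div_char_poly_minor:
  fixes A :: "'a :: idom mat"
  assumes A: "A \<in> carrier_mat n n" and root: "poly (char_poly A) a = 0"
    and idx: "i < n" "j < n" "k < n" "l < n"
  defines "G \<equiv> poly_eval_mat (synthetic_div (char_poly A) a) A"
  shows "G $$ (i, k) * G $$ (j, l) = G $$ (i, l) * G $$ (j, k)"
proof -
  let ?M = "char_poly_matrix A"
  have M: "?M \<in> carrier_mat n n" and det: "det ?M = char_poly A"
    using A by (simp_all add: char_poly_def)
  have "char_poly A \<noteq> 0"
    using degree_monic_char_poly[OF A] by auto
  then have "char_poly A dvd adj_mat ?M $$ (i, k) * adj_mat ?M $$ (j, l) - adj_mat ?M $$ (i, l) * adj_mat ?M $$ (j, k)"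
    using adj_mat_minor_dvd[OF M _ idx] by (simp add: det)
  then have "poly (adj_mat ?M $$ (i, k) * adj_mat ?M $$ (j, l) - adj_mat ?M $$ (i, l) * adj_mat ?M $$ (j, k)) a = 0"
    using root by (metis dvdE mult_zero_left poly_mult)
  then show ?thesis
    using poly_adj_char_poly_matrix[OF A] idx by (simp add: G_def)
qed

text \<open>Product rule for the factorization into linear factors: omitting one factor leaves the
  quotient by it. The roots form a list so that multiple roots are repeated.\<close>

lemma pderiv_alg_closed:
  fixes p :: "'a :: alg_closed_field poly"
  assumes "lead_coeff p = 1"
  obtains as where "\<And>i. i < length as \<Longrightarrow> poly p (as ! i) = 0"
    and "pderiv p = (\<Sum>i<length as. synthetic_div p (as ! i))"
proof -
  have "p \<noteq> 0"
    using assms by auto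
  then obtain S where "p = (\<Prod>x\<in>#S. [:-x, 1:])"
    using alg_closed_imp_factorization[of p] assms by auto
  moreover obtain as where "mset as = S"
    using ex_mset by blast
  ultimately have "p = (\<Prod>x\<leftarrow>as. [:-x, 1:])"
    by (metis mset_map prod_mset_prod_list)
  then have p: "p = (\<Prod>i<length as. [:- (as ! i), 1:])"
    by (simp add: prod.list_conv_set_nth atLeast0LessThan)
  have fac: "p = [:- (as ! i), 1:] * (\<Prod>j\<in>{..<length as} - {i}. [:- (as ! j), 1:])" if "i < length as" for i
    by (subst p, rule prod.remove) (use that in auto)
  have root: "poly p (as ! i) = 0" if "i < length as" for i
    by (subst fac[OF that]) simp
  have "(\<Prod>j\<in>{..<length as} - {i}. [:- (as ! j), 1:]) = synthetic_div p (as ! i)" if "i < length as" for i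
  proof -
    have "[:- (as ! i), 1:] * synthetic_div p (as ! i) = p"
      using synthetic_div_correct'[of "as ! i" p] root[OF that] by simp
    then have "[:- (as ! i), 1:] * synthetic_div p (as ! i) =
        [:- (as ! i), 1:] * (\<Prod>j\<in>{..<length as} - {i}. [:- (as ! j), 1:])"
      using fac[OF that] by simp
    then show ?thesis
      by (subst (asm) mult_cancel_left) simp
  qed
  moreover have "pderiv p = (\<Sum>i<length as. \<Prod>j\<in>{..<length as} - {i}. [:- (as ! j), 1:])"
    by (subst p) (simp add: pderiv_prod pderiv_pCons)
  ultimately show thesis
    by (intro that[of as] root) simp_all
qed

section \<open>Integral matrices\<close>

lemma integer_mats_iff:
  "A \<in> integer_mats n \<longleftrightarrow> A \<in> carrier_mat n n \<and> (\<forall>i<n. \<forall>j<n. algebraic_int (A $$ (i, j)))"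
  unfolding integer_mats_def ring_of_integers_def elements_mat_def
  by (auto simp: UN_subset_iff image_subset_iff)

lemma integer_mats_carrier: "A \<in> integer_mats n \<Longrightarrow> A \<in> carrier_mat n n"
  by (simp add: integer_mats_iff)

lemma integer_mats_index: "A \<in> integer_mats n \<Longrightarrow> i < n \<Longrightarrow> j < n \<Longrightarrow> algebraic_int (A $$ (i, j))"
  by (simp add: integer_mats_iff)

lemma integer_mats_mult:
  assumes "A \<in> integer_mats n" "B \<in> integer_mats n"
  shows "A * B \<in> integer_mats n"
  using assms
  by (auto simp: integer_mats_iff scalar_prod_def intro!: algebraic_int_sum algebraic_int_mult)

lemma integer_mats_of_int: "X \<in> carrier_mat n n \<Longrightarrow> map_mat of_int X \<in> integer_mats n"
  by (auto simp: integer_mats_iff)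

lemma integer_mats_poly_eval:
  assumes "A \<in> integer_mats n" "\<And>k. algebraic_int (coeff p k)"
  shows "poly_eval_mat p A \<in> integer_mats n"
  using assms(2)
proof (induction p)
  case 0
  then show ?case
    using integer_mats_carrier[OF assms(1)] by (simp add: poly_eval_mat_0 integer_mats_iff)
next
  case (pCons c p)
  have A: "A \<in> carrier_mat n n"
    by (rule integer_mats_carrier[OF assms(1)])
  have c: "algebraic_int c"
    using pCons.prems[of 0] by simp
  have "algebraic_int (coeff p k)" for k
    using pCons.prems[of "Suc k"] by simp
  then have "poly_eval_mat p A * A \<in> integer_mats n"
    by (intro integer_mats_mult pCons.IH assms(1))
  then show ?case
    unfolding poly_eval_mat_pCons[OF A] using c carrier_matD[OF A]
    by (auto simp: integer_mats_iff intro!: algebraic_int_add)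
qed

lemma algebraic_int_coeff_synthetic_div:
  fixes a :: "'a :: field_char_0"
  assumes "\<And>k. algebraic_int (coeff p k)" "algebraic_int a"
  shows "algebraic_int (coeff (synthetic_div p a) k)"
  unfolding coeff_synthetic_div poly_altdef using assms by (auto simp: coeff_poly_shift)

text \<open>With \<open>G = (\<chi> / (x - a))(X) = adj (a - X)\<close> for a root \<open>a\<close> of \<open>\<chi>\<close>, the vanishing of the
  2x2 minors of \<open>G\<close> yields \<open>(G Q)\<^sub>i\<^sub>j\<^sup>2 = G\<^sub>i\<^sub>i (Q\<^sup>T G Q)\<^sub>j\<^sub>j\<close>, which is integral although \<open>Q\<close> is not;
  and \<open>\<chi>'(X)\<close> is the sum of these \<open>G\<close>.\<close>

lemma pderiv_char_poly_mult_integral_alg_closed: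
  fixes X :: "int mat" and Q Y :: "'a :: {alg_closed_field, field_char_0} mat"
  assumes X: "X \<in> carrier_mat n n" and sym: "transpose_mat X = X"
    and Q: "Q \<in> carrier_mat n n" and QQ: "transpose_mat Q * Q \<in> integer_mats n"
    and Y: "Y \<in> integer_mats n" and XQ: "map_mat of_int X * Q = Q * Y"
  shows "poly_eval_mat (pderiv (char_poly (map_mat of_int X))) (map_mat of_int X) * Q \<in> integer_mats n"
proof -
  define X' :: "'a mat" where "X' = map_mat of_int X"
  define f where "f = char_poly X'"
  have X'int: "X' \<in> integer_mats n" and X': "X' \<in> carrier_mat n n" and Yc: "Y \<in> carrier_mat n n"
    using integer_mats_of_int[OF X] X integer_mats_carrier[OF Y] by (auto simp: X'_def)
  have symX': "transpose_mat X' = X'"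
    using sym by (simp add: X'_def map_mat_transpose)
  have f: "f = map_poly of_int (char_poly X)"
    unfolding f_def X'_def by (rule of_int_hom.char_poly_hom[OF X])
  have fint: "algebraic_int (coeff f k)" for k
    by (simp add: f)
  have monic: "lead_coeff f = 1"
    using degree_monic_char_poly[OF X'] by (simp add: f_def)
  have main: "algebraic_int ((poly_eval_mat (synthetic_div f a) X' * Q) $$ (i, j))"
    if root: "poly f a = 0" and ij: "i < n" "j < n" for a i j
  proof -
    define G where "G = poly_eval_mat (synthetic_div f a) X'"
    define H where "H = poly_eval_mat (synthetic_div f a) Y"
    have "algebraic_int a"
      using root monic unfolding f algebraic_int_altdef_ipoly
      by (intro exI[of _ "char_poly X"]) (simp add: degree_monic_char_poly[OF X])
    then have syn: "algebraic_int (coeff (synthetic_div f a) k)" for k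
      by (intro algebraic_int_coeff_synthetic_div fint)
    have G: "G \<in> integer_mats n" and H: "H \<in> integer_mats n"
      unfolding G_def H_def using X'int Y syn by (auto intro: integer_mats_poly_eval)
    have Gc: "G \<in> carrier_mat n n" and Hc: "H \<in> carrier_mat n n"
      using G H by (auto dest: integer_mats_carrier)
    have symG: "G $$ (k, l) = G $$ (l, k)" if "k < n" "l < n" for k l
      using arg_cong[OF poly_eval_mat_symmetric[OF X' symX', of "synthetic_div f a"], of "\<lambda>M. M $$ (l, k)"]
        that carrier_matD[OF X'] by (simp add: G_def)
    have minor: "G $$ (i, k) * G $$ (i, l) = G $$ (i, i) * G $$ (k, l)" if "k < n" "l < n" for k l
      using synthetic_div_char_poly_minor[OF X', of a i k i l] root ij that symG[of i k]
      by (simp add: G_def f_def mult.commute)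
    \<comment> \<open>Carrying \<open>G\<close> across \<open>Q\<close> turns Q^T G Q into (Q^T Q)
      H, a product of integral matrices.\<close>
    have GQ: "G * Q = Q * H"
      unfolding G_def H_def using poly_eval_mat_intertwine[OF X' Yc Q] XQ by (simp add: X'_def)
    have QGQ: "transpose_mat Q * (G * Q) = transpose_mat Q * Q * H"
      unfolding GQ using Q Hc by (intro assoc_mult_mat[symmetric]) auto
    have "((G * Q) $$ (i, j))\<^sup>2 = (\<Sum>k = 0..<n. \<Sum>l = 0..<n. (G $$ (i, k) * Q $$ (k, j)) * (G $$ (i, l) * Q $$ (l, j)))"
      using Gc Q ij by (simp add: scalar_prod_def power2_eq_square sum_product)
    also have "\<dots> = (\<Sum>k = 0..<n. \<Sum>l = 0..<n. G $$ (i, i) * (Q $$ (k, j) * (G $$ (k, l) * Q $$ (l, j))))"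
    proof (intro sum.cong refl)
      fix k l assume "k \<in> {0..<n}" "l \<in> {0..<n}"
      then have "G $$ (i, k) * G $$ (i, l) = G $$ (i, i) * G $$ (k, l)"
        by (intro minor) auto
      then have "(G $$ (i, k) * G $$ (i, l)) * (Q $$ (k, j) * Q $$ (l, j)) =
          (G $$ (i, i) * G $$ (k, l)) * (Q $$ (k, j) * Q $$ (l, j))"
        by simp
      then show "(G $$ (i, k) * Q $$ (k, j)) * (G $$ (i, l) * Q $$ (l, j)) =
          G $$ (i, i) * (Q $$ (k, j) * (G $$ (k, l) * Q $$ (l, j)))"
        by (simp only: ac_simps)
    qed
    also have "\<dots> = G $$ (i, i) * (transpose_mat Q * (G * Q)) $$ (j, j)"
      using Gc Q ij by (simp add: scalar_prod_def sum_distrib_left)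
    also have "\<dots> = G $$ (i, i) * (transpose_mat Q * Q * H) $$ (j, j)"
      by (simp add: QGQ)
    finally have "algebraic_int (((G * Q) $$ (i, j))\<^sup>2)"
      using integer_mats_index[OF G] integer_mats_index[OF integer_mats_mult[OF QQ H]] ij
      by (simp add: algebraic_int_mult)
    then show ?thesis
      unfolding G_def by (rule algebraic_int_power_imp) simp
  qed
  obtain as where as: "\<And>i. i < length as \<Longrightarrow> poly f (as ! i) = 0"
    and f': "pderiv f = (\<Sum>i<length as. synthetic_div f (as ! i))"
    using pderiv_alg_closed[OF monic] by blast
  have "algebraic_int ((poly_eval_mat (pderiv f) X' * Q) $$ (i, j))" if ij: "i < n" "j < n" for i j
  proof -
    have "(poly_eval_mat (pderiv f) X' * Q) $$ (i, j) =
        (\<Sum>k = 0..<n. \<Sum>m<length as. poly_eval_mat (synthetic_div f (as ! m)) X' $$ (i, k) * Q $$ (k, j))"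
      unfolding f' using ij Q X'
      by (simp add: scalar_prod_def poly_eval_mat_sum_index[OF X'] sum_distrib_right)
    also have "\<dots> = (\<Sum>m<length as. (poly_eval_mat (synthetic_div f (as ! m)) X' * Q) $$ (i, j))"
      using ij Q X' by (subst sum.swap) (simp add: scalar_prod_def)
    finally show ?thesis
      using main[OF as ij] by auto
  qed
  moreover have "poly_eval_mat (pderiv f) X' * Q \<in> carrier_mat n n"
    using poly_eval_mat_carrier[OF X'] Q by (rule mult_carrier_mat)
  ultimately show ?thesis
    unfolding integer_mats_iff f_def X'_def by blast
qed

text \<open>The hypotheses are transported to the algebraic closure by \<open>to_ac\<close>, and the
  conclusion is brought back because \<open>to_ac\<close> reflects integrality.\<close>

lemma pderiv_char_poly_mult_integral:
  fixes X :: "int mat" and Q Y :: "'k :: field_char_0 mat"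
  assumes X: "X \<in> carrier_mat n n" and sym: "transpose_mat X = X"
    and Q: "Q \<in> carrier_mat n n" and QQ: "transpose_mat Q * Q \<in> integer_mats n"
    and Y: "Y \<in> integer_mats n" and XQ: "map_mat of_int X * Q = Q * Y"
  shows "map_mat of_int (poly_eval_mat (pderiv (char_poly X)) X) * Q \<in> integer_mats n"
proof -
  interpret ac: comm_ring_hom "to_ac :: 'k \<Rightarrow> _"
    by unfold_locales simp_all
  let ?A = "poly_eval_mat (pderiv (char_poly X)) X"
  let ?Q = "map_mat to_ac Q" and ?Y = "map_mat to_ac Y"
  have int_iff: "map_mat to_ac M \<in> integer_mats n \<longleftrightarrow> M \<in> integer_mats n" for M :: "'k mat"
    by (auto simp: integer_mats_iff)
  have Yc: "Y \<in> carrier_mat n n"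
    by (rule integer_mats_carrier[OF Y])
  have of_int: "map_mat to_ac (map_mat of_int M) = map_mat of_int M" for M
    by (rule eq_matI) auto
  have "map_mat of_int X * ?Q = ?Q * ?Y"
    using arg_cong[OF XQ, of "map_mat to_ac"] X Q Yc
    by (simp add: ac.mat_hom_mult[of _ n n _ n] of_int)
  moreover have "transpose_mat ?Q * ?Q = map_mat to_ac (transpose_mat Q * Q)"
    using Q by (simp add: ac.mat_hom_mult[of _ n n _ n] map_mat_transpose)
  ultimately have "poly_eval_mat (pderiv (char_poly (map_mat of_int X))) (map_mat of_int X) * ?Q \<in> integer_mats n"
    using QQ Y Q by (intro pderiv_char_poly_mult_integral_alg_closed[OF X sym, of _ ?Y])
      (simp_all add: int_iff)
  also have "poly_eval_mat (pderiv (char_poly (map_mat of_int X))) (map_mat of_int X) =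
      (map_mat of_int ?A :: 'k alg_closure mat)"
    by (simp add: of_int_hom.poly_eval_mat_hom[OF X] of_int_hom.char_poly_hom[OF X] of_int_hom.map_poly_pderiv)
  also have "map_mat of_int ?A * ?Q = map_mat to_ac (map_mat of_int ?A * Q)"
    using X Q by (simp add: ac.mat_hom_mult[of _ n n _ n] of_int)
  finally show ?thesis
    by (simp only: int_iff)
qed

section \<open>Primes that divide the determinant exactly once\<close>

text \<open>If \<open>p\<close> divided the whole diagonal of the adjugate \<open>B\<close>, the
  principal 2x2 minors and symmetry would make it divide every B_ij^2, hence all of
  \<open>B\<close>. Taking determinants in \<open>A * (B / p) = (det A / p) * 1\<close> then gives p
  | det A / p, against the assumption on p^2.\<close>

lemma squarefree_det_adj_diag:
  fixes A :: "int mat"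
  assumes A: "A \<in> carrier_mat n n" and sym: "transpose_mat A = A" and D: "det A \<noteq> 0"
    and p: "prime p" "p dvd det A" "\<not> p\<^sup>2 dvd det A"
  obtains i where "i < n" "\<not> p dvd adj_mat A $$ (i, i)"
proof (rule ccontr)
  assume "\<not> thesis"
  then have diag: "p dvd adj_mat A $$ (i, i)" if "i < n" for i
    using that \<open>\<And>i. i < n \<Longrightarrow> \<not> p dvd adj_mat A $$ (i, i) \<Longrightarrow> thesis\<close> by blast
  define B where "B = adj_mat A"
  have B: "B \<in> carrier_mat n n" and AB: "A * B = det A \<cdot>\<^sub>m 1\<^sub>m n"
    using adj_mat[OF A] by (simp_all add: B_def)
  have dvd: "p dvd B $$ (i, j)" if ij: "i < n" "j < n" for i j
  proof -
    have "B $$ (j, i) = B $$ (i, j)"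
      using arg_cong[OF adj_mat_symmetric[OF A sym D], of "\<lambda>M. M $$ (i, j)"] ij B by (simp add: B_def)
    moreover have "det A dvd B $$ (i, i) * B $$ (j, j) - B $$ (i, j) * B $$ (j, i)"
      unfolding B_def by (rule adj_mat_minor_dvd[OF A D]) (use ij in auto)
    ultimately have "p dvd B $$ (i, i) * B $$ (j, j) - B $$ (i, j) * B $$ (i, j)"
      using p(2) dvd_trans by metis
    moreover have "p dvd B $$ (i, i) * B $$ (j, j)"
      using diag[OF ij(1)] by (simp add: B_def)
    ultimately have "p dvd B $$ (i, j) * B $$ (i, j)"
      by (metis dvd_diff_right_iff)
    then show ?thesis
      using p(1) prime_dvd_mult_iff by blast
  qed
  define B' where "B' = map_mat (\<lambda>b. b div p) B"
  have B': "B' \<in> carrier_mat n n"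
    using B by (simp add: B'_def)
  have "A * B' = (det A div p) \<cdot>\<^sub>m 1\<^sub>m n"
  proof (rule eq_matI)
    fix i j assume "i < dim_row ((det A div p) \<cdot>\<^sub>m 1\<^sub>m n :: int mat)" "j < dim_col ((det A div p) \<cdot>\<^sub>m 1\<^sub>m n :: int mat)"
    then have ij: "i < n" "j < n"
      by auto
    have "p * (A * B') $$ (i, j) = (\<Sum>k = 0..<n. A $$ (i, k) * (p * (B $$ (k, j) div p)))"
      using A B ij by (simp add: B'_def scalar_prod_def sum_distrib_left mult.left_commute)
    also have "\<dots> = (A * B) $$ (i, j)"
      using A B ij dvd by (simp add: scalar_prod_def)
    also have "\<dots> = p * (((det A div p) \<cdot>\<^sub>m 1\<^sub>m n) $$ (i, j))"
      unfolding AB using ij p(2) by simp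
    finally show "(A * B') $$ (i, j) = ((det A div p) \<cdot>\<^sub>m 1\<^sub>m n) $$ (i, j)"
      using p(1) by simp
  qed (use A B' in auto)
  then have "det A * det B' = (det A div p) ^ n"
    using det_mult[OF A B'] by simp
  then have "p dvd (det A div p) ^ n"
    using p(2) by (metis dvd_mult2)
  then have "p dvd det A div p"
    using p(1) prime_dvd_power by blast
  then have "p\<^sup>2 dvd det A"
    using p(1,2) by (simp add: dvd_div_iff_mult power2_eq_square)
  then show False
    using p(3) by blast
qed

text \<open>The integers that make \<open>q\<close> integral form an ideal, generated by its least
  positive member \<open>d\<close>. A prime \<open>r\<close> dividing \<open>d\<close> would divide
  \<open>D\<close>, and \<open>d\<close> would divide \<open>D div r\<close>, so r^2 would divide
  \<open>D\<close>; hence \<open>d = 1\<close>.\<close>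

lemma algebraic_int_if_squarefree_multiple:
  fixes q :: "'k :: field_char_0" and D :: int
  assumes D: "D \<noteq> 0" "algebraic_int (of_int D * q)"
    and p: "\<And>p. prime p \<Longrightarrow> p dvd D \<Longrightarrow> \<not> p\<^sup>2 dvd D \<and> algebraic_int (of_int (D div p) * q)"
  shows "algebraic_int q"
proof -
  define I where "I = {m :: int. algebraic_int (of_int m * q)}"
  have "\<exists>d. 0 < d \<and> int d \<in> I"
  proof (cases "D > 0")
    case True
    then show ?thesis
      using D by (intro exI[of _ "nat D"]) (simp add: I_def)
  next
    case False
    then show ?thesis
      using D algebraic_int_minus[OF D(2)] by (intro exI[of _ "nat (- D)"]) (simp add: I_def)
  qed
  then obtain d where d: "0 < d" "int d \<in> I" and least: "\<And>m. 0 < m \<Longrightarrow> int m \<in> I \<Longrightarrow> d \<le> m"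
    using LeastI_ex[of "\<lambda>d. 0 < d \<and> int d \<in> I"] Least_le[of "\<lambda>d. 0 < d \<and> int d \<in> I"] by blast
  have dvd: "int d dvd m" if m: "m \<in> I" for m
  proof (rule ccontr)
    assume "\<not> int d dvd m"
    then have r: "m mod int d > 0"
      using d(1) by (simp add: dvd_eq_mod_eq_0 order_le_neq_trans[OF pos_mod_sign])
    have "of_int (m mod int d) * q = of_int m * q - of_int (m div int d) * (of_int (int d) * q)"
      by (simp add: minus_mult_div_eq_mod[symmetric] algebra_simps)
    also have "algebraic_int \<dots>"
      using m d(2) unfolding I_def
      by (intro algebraic_int_diff[OF _ algebraic_int_mult[OF algebraic_int_of_int]]) simp_all
    finally have "int (nat (m mod int d)) \<in> I"
      using r by (simp add: I_def)
    then have "d \<le> nat (m mod int d)"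
      using r by (intro least) auto
    moreover have "m mod int d < int d"
      using d(1) by simp
    ultimately show False
      using r by linarith
  qed
  have "d = 1"
  proof (rule ccontr)
    assume "d \<noteq> 1"
    then obtain r :: nat where r: "prime r" "r dvd d"
      using prime_factor_nat by blast
    have "int d dvd D"
      using D(2) by (intro dvd) (simp add: I_def)
    then have rD: "int r dvd D"
      using r(2) by (meson dvd_trans of_nat_dvd_iff)
    have "int d dvd D div int r"
      using p[of "int r"] r(1) rD by (intro dvd) (simp add: I_def)
    then have "int r dvd D div int r"
      using r(2) by (meson dvd_trans of_nat_dvd_iff)
    then have "(int r)\<^sup>2 dvd D"
      using r(1) rD by (simp add: dvd_div_iff_mult power2_eq_square)
    then show False
      using p[of "int r"] r(1) rD by simp
  qed
  then show ?thesis
    using d(2) by (simp add: I_def)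
qed

lemma of_int_adj_mat_mult:
  fixes Q :: "'a :: comm_ring_1 mat"
  assumes A: "A \<in> carrier_mat n n" and Q: "Q \<in> carrier_mat n n"
  shows "map_mat of_int (adj_mat A) * (map_mat of_int A * Q) = of_int (det A) \<cdot>\<^sub>m Q"
proof -
  note B = adj_mat(1)[OF A]
  have "map_mat of_int (adj_mat A) * (map_mat of_int A * Q) = map_mat of_int (adj_mat A) * map_mat of_int A * Q"
    using A B Q by (intro assoc_mult_mat[symmetric]) auto
  also have "map_mat of_int (adj_mat A) * map_mat of_int A = (map_mat of_int (adj_mat A * A) :: 'a mat)"
    by (rule of_int_hom.mat_hom_mult[OF B A, symmetric])
  also have "\<dots> = of_int (det A) \<cdot>\<^sub>m 1\<^sub>m n"
    unfolding adj_mat(3)[OF A] by (rule eq_matI) auto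
  also have "(of_int (det A) \<cdot>\<^sub>m 1\<^sub>m n * Q) = of_int (det A) \<cdot>\<^sub>m Q"
    using Q by (simp add: mult_smult_assoc_mat[of _ n n])
  finally show ?thesis .
qed

text \<open>Writing \<open>Z = A Q\<close> and \<open>B = adj A\<close>, the \<open>j\<close>-th diagonal entry of \<open>Z\<^sup>T B Z = det A * (Q\<^sup>T A Q)\<close>
  lies in \<open>p O\<close>. As \<open>B\<close> has rank one modulo \<open>p\<close>, this entry times \<open>B\<^sub>i\<^sub>i\<close> is congruent to the square
  of the \<open>(i, j)\<close> entry of \<open>B Z = det A * Q\<close>.\<close>

lemma div_prime_mult_integral:
  fixes A :: "int mat" and Q :: "'k :: field_char_0 mat"
  assumes A: "A \<in> carrier_mat n n" and sym: "transpose_mat A = A" and D: "det A \<noteq> 0"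
    and p: "prime p" "p dvd det A" "\<not> p\<^sup>2 dvd det A"
    and reduced: "\<And>a :: 'k. algebraic_int a \<Longrightarrow> algebraic_int (a\<^sup>2 / of_int p) \<Longrightarrow> algebraic_int (a / of_int p)"
    and Q: "Q \<in> carrier_mat n n" and Z: "map_mat of_int A * Q \<in> integer_mats n"
    and W: "transpose_mat Q * (map_mat of_int A * Q) \<in> integer_mats n"
    and kj: "k < n" "j < n"
  shows "algebraic_int (of_int (det A div p) * Q $$ (k, j))"
proof -
  obtain i where i: "i < n" "\<not> p dvd adj_mat A $$ (i, i)"
    using squarefree_det_adj_diag[OF A sym D p] by blast
  define B where "B = adj_mat A"
  have B: "B \<in> carrier_mat n n"
    using adj_mat(1)[OF A] by (simp add: B_def)
  have symB: "B $$ (k, l) = B $$ (l, k)" if "k < n" "l < n" for k l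
    using arg_cong[OF adj_mat_symmetric[OF A sym D], of "\<lambda>M. M $$ (l, k)"] that B by (simp add: B_def)
  have minor: "\<exists>m. B $$ (i, i) * B $$ (k, l) = B $$ (i, k) * B $$ (i, l) + p * m" if "k < n" "l < n" for k l
  proof -
    have "det A dvd B $$ (i, i) * B $$ (k, l) - B $$ (i, l) * B $$ (k, i)"
      unfolding B_def by (rule adj_mat_minor_dvd[OF A D]) (use i(1) that in auto)
    then have "p dvd B $$ (i, i) * B $$ (k, l) - B $$ (i, l) * B $$ (k, i)"
      using p(2) dvd_trans by blast
    then obtain m where "B $$ (i, i) * B $$ (k, l) - B $$ (i, l) * B $$ (k, i) = p * m" ..
    then show ?thesis
      using symB[OF that(1) i(1)] by (intro exI[of _ m]) (simp add: algebra_simps)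
  qed
  then obtain m where m: "B $$ (i, i) * B $$ (k, l) = B $$ (i, k) * B $$ (i, l) + p * m k l"
    if "k < n" "l < n" for k l
    by metis
  have m': "of_int (B $$ (i, i)) * of_int (B $$ (k, l)) =
      of_int (B $$ (i, k)) * of_int (B $$ (i, l)) + of_int p * (of_int (m k l) :: 'k)"
    if "k < n" "l < n" for k l
    using m[OF that] by (metis of_int_add of_int_mult)
  define P :: 'k where "P = of_int p"
  have P0: "P \<noteq> 0"
    using p(1) by (auto simp: P_def)
  define z where "z = (\<lambda>k. (map_mat of_int A * Q) $$ (k, j))"
  define y where "y = (\<lambda>k. \<Sum>l = 0..<n. of_int (B $$ (k, l)) * z l)"
  have z: "algebraic_int (z k)" if "k < n" for k
    using integer_mats_index[OF Z that kj(2)] by (simp add: z_def)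
  have y_int: "algebraic_int (y k)" if "k < n" for k
    unfolding y_def using z by (intro algebraic_int_sum algebraic_int_mult) auto
  have y: "y k = of_int (det A) * Q $$ (k, j)" if "k < n" for k
  proof -
    have "y k = (map_mat of_int B * (map_mat of_int A * Q)) $$ (k, j)"
      using that kj A B Q by (simp add: y_def z_def scalar_prod_def)
    also have "map_mat of_int B * (map_mat of_int A * Q) = of_int (det A) \<cdot>\<^sub>m Q"
      unfolding B_def by (rule of_int_adj_mat_mult[OF A Q])
    finally show ?thesis
      using that kj Q by simp
  qed
  have DP: "of_int (det A) = of_int (det A div p) * P"
    using p(2) by (simp add: P_def flip: of_int_mult)
  \<comment> \<open>Here \<open>z\<close> is the column \<open>j\<close> of \<open>Z\<close> and
    \<open>y = B z\<close> is \<open>det A\<close> times that of \<open>Q\<close>, so the sum is the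
    diagonal entry of Z^T B Z.\<close>
  have "(\<Sum>k = 0..<n. z k * y k) = of_int (det A) * (transpose_mat Q * (map_mat of_int A * Q)) $$ (j, j)"
    using kj A Q by (simp add: y z_def scalar_prod_def sum_distrib_left mult_ac)
  then have zy: "(\<Sum>k = 0..<n. z k * y k) / P =
      of_int (det A div p) * (transpose_mat Q * (map_mat of_int A * Q)) $$ (j, j)"
    using P0 by (simp add: DP)
  have sq: "(y i)\<^sup>2 = (\<Sum>k = 0..<n. \<Sum>l = 0..<n. (of_int (B $$ (i, k)) * z k) * (of_int (B $$ (i, l)) * z l))"
    by (simp add: y_def power2_eq_square sum_product)
  have "of_int (B $$ (i, i)) * (\<Sum>k = 0..<n. z k * y k) =
      (\<Sum>k = 0..<n. \<Sum>l = 0..<n. (of_int (B $$ (i, i)) * of_int (B $$ (k, l))) * (z k * z l))"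
    by (simp add: y_def sum_distrib_left mult_ac)
  also have "\<dots> = (\<Sum>k = 0..<n. \<Sum>l = 0..<n. (of_int (B $$ (i, k)) * z k) * (of_int (B $$ (i, l)) * z l)
      + P * (of_int (m k l) * (z k * z l)))"
    by (intro sum.cong refl, subst m') (simp_all add: P_def algebra_simps)
  also have "\<dots> = (y i)\<^sup>2 + P * (\<Sum>k = 0..<n. \<Sum>l = 0..<n. of_int (m k l) * (z k * z l))"
    unfolding sq by (simp add: sum.distrib sum_distrib_left)
  finally have "(y i)\<^sup>2 / P = of_int (B $$ (i, i)) * ((\<Sum>k = 0..<n. z k * y k) / P)
      - (\<Sum>k = 0..<n. \<Sum>l = 0..<n. of_int (m k l) * (z k * z l))"
    using P0 by (simp add: field_simps)
  also have "algebraic_int \<dots>"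
    unfolding zy using z integer_mats_index[OF W kj(2) kj(2)]
    by (intro algebraic_int_diff algebraic_int_mult algebraic_int_sum) auto
  finally have yi: "algebraic_int (y i / P)"
    using reduced y_int[OF i(1)] unfolding P_def by blast
  \<comment> \<open>The rank one congruence in linear form: \<open>B_ii y_k\<close> is congruent to
    \<open>B_ik y_i\<close> modulo \<open>p\<close>, so the divisibility of \<open>y_i\<close>
    passes to \<open>B_ii y_k\<close>. The unit \<open>B_ii\<close> is then removed by
    Bezout.\<close>
  have "of_int (B $$ (i, i)) * y k = (\<Sum>l = 0..<n. (of_int (B $$ (i, i)) * of_int (B $$ (k, l))) * z l)"
    by (simp add: y_def sum_distrib_left mult_ac)
  also have "\<dots> = (\<Sum>l = 0..<n. of_int (B $$ (i, k)) * (of_int (B $$ (i, l)) * z l) + P * (of_int (m k l) * z l))"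
    by (intro sum.cong refl, subst m') (simp_all add: P_def kj(1) algebra_simps)
  also have "\<dots> = of_int (B $$ (i, k)) * y i + P * (\<Sum>l = 0..<n. of_int (m k l) * z l)"
    by (simp add: y_def sum.distrib sum_distrib_left)
  finally have Bii: "of_int (B $$ (i, i)) * (y k / P) = of_int (B $$ (i, k)) * (y i / P)
      + (\<Sum>l = 0..<n. of_int (m k l) * z l)"
    using P0 by (simp add: field_simps)
  have Bii_int: "algebraic_int (of_int (B $$ (i, i)) * (y k / P))"
    unfolding Bii using yi z by (intro algebraic_int_add algebraic_int_mult algebraic_int_sum) auto
  have "coprime (B $$ (i, i)) p"
    using i(2) p(1) by (metis B_def coprime_commute prime_imp_coprime)
  then obtain b c where bc: "b * B $$ (i, i) + c * p = 1"
    using bezout_int[of "B $$ (i, i)" p] by (metis coprime_imp_gcd_eq_1)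
  have "y k / P = of_int (b * B $$ (i, i) + c * p) * (y k / P)"
    by (simp add: bc)
  also have "\<dots> = of_int b * (of_int (B $$ (i, i)) * (y k / P)) + of_int c * y k"
    using P0 by (simp add: P_def field_simps)
  also have "algebraic_int \<dots>"
    by (rule algebraic_int_add[OF algebraic_int_mult[OF algebraic_int_of_int Bii_int]
          algebraic_int_mult[OF algebraic_int_of_int y_int[OF kj(1)]]])
  finally have "algebraic_int (y k / P)" .
  also have "y k / P = of_int (det A div p) * Q $$ (k, j)"
    using P0 by (simp add: y[OF kj(1)] DP)
  finally show ?thesis .
qed

theorem corollary2p12:
  fixes n :: nat and X :: "int mat" and Q Y :: "'k :: field_char_0 mat"
  assumes "number_field TYPE('k)"
    and "X \<in> carrier_mat n n" and "transpose_mat X = X"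
    and "Q \<in> carrier_mat n n" and "Q \<noteq> 0\<^sub>m n n"
    and "transpose_mat Q * Q \<in> integer_mats n"
    and "Y \<in> integer_mats n" and "map_mat of_int X * Q = Q * Y"
    and "mat_discriminant X \<noteq> 0"
    and "\<forall>p \<in> prime_factors (mat_discriminant X). \<not> ramified_in TYPE('k) p"
    and "\<forall>p \<in> prime_factors (mat_discriminant X). multiplicity p (mat_discriminant X) \<le> 1"
  shows "level n Q = carrier ring_of_integers"
proof -
  note X = assms(2) and Q = assms(4)
  define A where "A = poly_eval_mat (pderiv (char_poly X)) X"
  have A: "A \<in> carrier_mat n n" and symA: "transpose_mat A = A" and D: "det A \<noteq> 0"
    using poly_eval_mat_symmetric[OF X assms(3)] poly_eval_mat_carrier[OF X] assms(9)
    by (simp_all add: A_def mat_discriminant_def)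
  have Z: "map_mat of_int A * Q \<in> integer_mats n"
    unfolding A_def by (rule pderiv_char_poly_mult_integral[OF X assms(3) Q assms(6-8)])
  define f' :: "'k poly" where "f' = map_poly of_int (pderiv (char_poly X))"
  have Y: "Y \<in> carrier_mat n n" and X': "map_mat of_int X \<in> carrier_mat n n"
    using integer_mats_carrier[OF assms(7)] X by simp_all
  \<comment> \<open>Crossing \<open>Q\<close> replaces \<chi>'(X) by \<chi>'(Y), so Q^T A Q becomes
    the product of the integral matrices Q^T Q and \<chi>'(Y).\<close>
  have "map_mat of_int A * Q = Q * poly_eval_mat f' Y"
    using poly_eval_mat_intertwine[OF X' Y Q assms(8)]
    by (simp add: A_def f'_def of_int_hom.poly_eval_mat_hom[OF X])
  then have "transpose_mat Q * (map_mat of_int A * Q) = transpose_mat Q * Q * poly_eval_mat f' Y"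
    using Q Y by (simp add: assoc_mult_mat[of _ n n _ n _ n])
  moreover have "poly_eval_mat f' Y \<in> integer_mats n"
    by (rule integer_mats_poly_eval[OF assms(7)]) (simp add: f'_def)
  ultimately have W: "transpose_mat Q * (map_mat of_int A * Q) \<in> integer_mats n"
    using assms(6) by (simp add: integer_mats_mult)
  have "algebraic_int (Q $$ (i, j))" if ij: "i < n" "j < n" for i j
  proof (rule algebraic_int_if_squarefree_multiple[OF D])
    show "\<not> p\<^sup>2 dvd det A \<and> algebraic_int (of_int (det A div p) * Q $$ (i, j))"
      if p: "prime p" "p dvd det A" for p
    proof -
      have fac: "p \<in> prime_factors (mat_discriminant X)"
        using p D by (simp add: A_def mat_discriminant_def prime_factors_dvd)
      have "multiplicity p (det A) \<le> 1"
        using assms(11) fac by (simp add: A_def mat_discriminant_def)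
      then have sq: "\<not> p\<^sup>2 dvd det A"
        using multiplicity_geI[of "det A" p 2] D p(1) by force
      have "\<not> ramified_in TYPE('k) p"
        using assms(10) fac by blast
      \<comment> \<open>Contrapositive of the ramification criterion: O/pO has no nonzero element of
        square zero.\<close>
      then have "algebraic_int (a / of_int p)" if "algebraic_int a" "algebraic_int (a\<^sup>2 / of_int p)" for a :: 'k
        using ramified_in_if_nilpotent_residue[OF assms(1) p(1)] that by blast
      then show ?thesis
        using div_prime_mult_integral[OF A symA D p sq _ Q Z W ij] sq by blast
    qed
    show "algebraic_int (of_int (det A) * Q $$ (i, j))"
      using integer_mats_index[OF integer_mats_mult[OF integer_mats_of_int[OF adj_mat(1)[OF A]] Z] ij] ij Q
      by (simp add: of_int_adj_mat_mult[OF A Q])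
  qed
  then have "Q \<in> integer_mats n"
    using Q by (simp add: integer_mats_iff)
  then have "r \<cdot>\<^sub>m Q \<in> integer_mats n" if "algebraic_int r" for r
    using that by (auto simp: integer_mats_iff intro!: algebraic_int_mult)
  then show ?thesis
    unfolding level_def by (auto simp: ring_of_integers_def)
qed

end
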